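(* Let $H$ be an irreducible affine algebraic group over an algebraically closed field $\Bbbk$ such that every regular action of $H$ on an affine algebraic variety is observable. Then $H$ is unipotent.
   Context: The action of $H$ on an affine variety $X$ is observable if for every $H$--stable closed subset $Y\subsetneq X$ there exists a nonzero $H$--invariant $f\in\Bbbk[X]$ vanishing on $Y$. *)

theory Defs
  imports "HOL-Computational_Algebra.Polynomial"
begin

text \<open>Points of affine m-space over 'k are lists of length m.
  polyfun n = polynomial functions in the n coordinates.\<close>

inductive_set polyfun :: "nat \<Rightarrow> ('k::field list \<Rightarrow> 'k) set" for n :: nat where
  const: "(\<lambda>x. c) \<in> polyfun n"
| coord: "i < n \<Longrightarrow> (\<lambda>x. x ! i) \<in> polyfun n"
| add: "p \<in> polyfun n \<Longrightarrow> q \<in> polyfun n \<Longrightarrow> (\<lambda>x. p x + q x) \<in> polyfun n"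
| mult: "p \<in> polyfun n \<Longrightarrow> q \<in> polyfun n \<Longrightarrow> (\<lambda>x. p x * q x) \<in> polyfun n"

definition alg_closed_field :: "'k::field itself \<Rightarrow> bool" where
  "alg_closed_field _ \<longleftrightarrow> (\<forall>p :: 'k poly. degree p > 0 \<longrightarrow> (\<exists>x. poly p x = 0))"

definition zariski_closed :: "nat \<Rightarrow> 'k::field list set \<Rightarrow> bool" where
  "zariski_closed n X \<longleftrightarrow>
     (\<exists>F. F \<subseteq> polyfun n \<and> X = {x. length x = n \<and> (\<forall>f\<in>F. f x = 0)})"

definition irreducible_closed :: "nat \<Rightarrow> 'k::field list set \<Rightarrow> bool" where
  "irreducible_closed n X \<longleftrightarrow> zariski_closed n X \<and> X \<noteq> {} \<and>
     (\<forall>Y Z. zariski_closed n Y \<and> zariski_closed n Z \<and> X = Y \<union> Z \<longrightarrow> X = Y \<or> X = Z)"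

definition poly_map :: "nat \<Rightarrow> nat \<Rightarrow> ('k::field list \<Rightarrow> 'k list) \<Rightarrow> 'k list set \<Rightarrow> bool" where
  "poly_map n m F S \<longleftrightarrow>
     (\<exists>P. (\<forall>i<m. P i \<in> polyfun n) \<and> (\<forall>z\<in>S. F z = map (\<lambda>i. P i z) [0..<m]))"

definition affine_algebraic_group ::
  "nat \<Rightarrow> 'k::field list set \<Rightarrow> ('k list \<Rightarrow> 'k list \<Rightarrow> 'k list) \<Rightarrow> ('k list \<Rightarrow> 'k list) \<Rightarrow> 'k list \<Rightarrow> bool" where
  "affine_algebraic_group n H mul ginv e \<longleftrightarrow>
     zariski_closed n H \<and> e \<in> H \<and>
     (\<forall>g\<in>H. \<forall>h\<in>H. mul g h \<in> H) \<and> (\<forall>g\<in>H. ginv g \<in> H) \<and>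
     (\<forall>g\<in>H. \<forall>h\<in>H. \<forall>k\<in>H. mul (mul g h) k = mul g (mul h k)) \<and>
     (\<forall>g\<in>H. mul e g = g \<and> mul g e = g) \<and>
     (\<forall>g\<in>H. mul (ginv g) g = e \<and> mul g (ginv g) = e) \<and>
     poly_map (n + n) n (\<lambda>z. mul (take n z) (drop n z)) {g @ h | g h. g \<in> H \<and> h \<in> H} \<and>
     poly_map n n ginv H"

definition regular_action ::
  "nat \<Rightarrow> 'k::field list set \<Rightarrow> ('k list \<Rightarrow> 'k list \<Rightarrow> 'k list) \<Rightarrow> 'k list \<Rightarrow>
   nat \<Rightarrow> 'k list set \<Rightarrow> ('k list \<Rightarrow> 'k list \<Rightarrow> 'k list) \<Rightarrow> bool" where
  "regular_action n H mul e m X act \<longleftrightarrow>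
     zariski_closed m X \<and>
     (\<forall>h\<in>H. \<forall>x\<in>X. act h x \<in> X) \<and>
     (\<forall>x\<in>X. act e x = x) \<and>
     (\<forall>g\<in>H. \<forall>h\<in>H. \<forall>x\<in>X. act (mul g h) x = act g (act h x)) \<and>
     poly_map (n + m) m (\<lambda>z. act (take n z) (drop n z)) {h @ x | h x. h \<in> H \<and> x \<in> X}"

text \<open>Observability, as in the paper: every H-stable closed proper subset Y of X
  is contained in the zero set of a nonzero H-invariant regular function on X
  (regular functions on X = restrictions of polynomial functions).\<close>
definition observable_action ::
  "'k::field list set \<Rightarrow> nat \<Rightarrow> 'k list set \<Rightarrow> ('k list \<Rightarrow> 'k list \<Rightarrow> 'k list) \<Rightarrow> bool" where
  "observable_action H m X act \<longleftrightarrow>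
     (\<forall>Y. zariski_closed m Y \<and> Y \<subseteq> X \<and> Y \<noteq> X \<and> (\<forall>h\<in>H. \<forall>y\<in>Y. act h y \<in> Y) \<longrightarrow>
        (\<exists>f\<in>polyfun m. (\<exists>x\<in>X. f x \<noteq> 0) \<and>
            (\<forall>h\<in>H. \<forall>x\<in>X. f (act h x) = f x) \<and> (\<forall>y\<in>Y. f y = 0)))"

text \<open>m x m matrices as functions on indices < m.\<close>
definition mat_id :: "nat \<Rightarrow> nat \<Rightarrow> 'k::field" where
  "mat_id i j = (if i = j then 1 else 0)"

definition mat_mul :: "nat \<Rightarrow> (nat \<Rightarrow> nat \<Rightarrow> 'k::field) \<Rightarrow> (nat \<Rightarrow> nat \<Rightarrow> 'k) \<Rightarrow> nat \<Rightarrow> nat \<Rightarrow> 'k" where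
  "mat_mul m A B = (\<lambda>i j. \<Sum>k<m. A i k * B k j)"

primrec mat_pow :: "nat \<Rightarrow> (nat \<Rightarrow> nat \<Rightarrow> 'k::field) \<Rightarrow> nat \<Rightarrow> nat \<Rightarrow> nat \<Rightarrow> 'k" where
  "mat_pow m A 0 = mat_id"
| "mat_pow m A (Suc N) = mat_mul m A (mat_pow m A N)"

definition rational_rep ::
  "nat \<Rightarrow> 'k::field list set \<Rightarrow> ('k list \<Rightarrow> 'k list \<Rightarrow> 'k list) \<Rightarrow> 'k list \<Rightarrow>
   nat \<Rightarrow> ('k list \<Rightarrow> nat \<Rightarrow> nat \<Rightarrow> 'k) \<Rightarrow> bool" where
  "rational_rep n H mul e m \<rho> \<longleftrightarrow>
     (\<forall>i<m. \<forall>j<m. \<exists>p\<in>polyfun n. \<forall>h\<in>H. \<rho> h i j = p h) \<and>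
     (\<forall>i<m. \<forall>j<m. \<rho> e i j = mat_id i j) \<and>
     (\<forall>g\<in>H. \<forall>h\<in>H. \<forall>i<m. \<forall>j<m. \<rho> (mul g h) i j = mat_mul m (\<rho> g) (\<rho> h) i j)"

definition unipotent_group ::
  "nat \<Rightarrow> 'k::field list set \<Rightarrow> ('k list \<Rightarrow> 'k list \<Rightarrow> 'k list) \<Rightarrow> 'k list \<Rightarrow> bool" where
  "unipotent_group n H mul e \<longleftrightarrow>
     (\<forall>m \<rho>. rational_rep n H mul e m \<rho> \<longrightarrow>
        (\<forall>h\<in>H. \<exists>N. \<forall>i<m. \<forall>j<m.
            mat_pow m (\<lambda>a b. \<rho> h a b - mat_id a b) N i j = 0))"

end

theory Submission
  imports Defs
begin

text \<open>It suffices that every representation of positive dimension has a nonzero fixed vector; then one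
  passes to the quotient by its line. Let \<open>I\<close> be maximal among the \<open>H\<close>-stable homogeneous
  ideals that contain no power of the irrelevant ideal, and let \<open>v \<noteq> 0\<close> be a zero of \<open>I\<close>. If \<open>0\<close>
  were in the closure of \<open>H v\<close>, an invariant vanishing at \<open>0\<close> would vanish on the whole closure,
  against observability. The leading forms of the polynomials vanishing on \<open>H v\<close> make up an \<open>H\<close>-stable
  homogeneous ideal \<open>J \<supseteq> I\<close>. If \<open>J = I\<close>, stripping leading forms one at a time shows that every
  polynomial vanishing on \<open>H v\<close> vanishes at \<open>0\<close>, which was excluded. So \<open>J\<close> contains all forms of
  some degree, the functions on \<open>H v\<close> form a finite-dimensional space, the coordinates take
  finitely many values on \<open>H v\<close>, and since \<open>H\<close> is irreducible, \<open>v\<close> is fixed.\<close>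

section \<open>Linear dependence of functions\<close>

text \<open>Gaussian elimination by induction on the set of equations: if equation \<open>b\<close>
  has a nonzero coefficient, the corresponding unknown is eliminated from the other equations, and
  both counts drop by one.\<close>

lemma homogeneous_system_solution:
  fixes a :: "'i \<Rightarrow> 'b \<Rightarrow> 'k::field"
  assumes "finite B" "finite I" "card B < card I"
  shows "\<exists>c. (\<exists>i\<in>I. c i \<noteq> 0) \<and> (\<forall>b\<in>B. (\<Sum>i\<in>I. c i * a i b) = 0)"
  using assms
proof (induction B arbitrary: I a rule: finite_induct)
  case empty
  then obtain i where "i \<in> I" by fastforce
  then show ?case by (intro exI[of _ "\<lambda>_. 1"]) auto
next
  case (insert b B)
  show ?case
  proof (cases "\<forall>i\<in>I. a i b = 0")
    case True
    with insert.IH[of I a] insert.prems insert.hyps show ?thesis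
      by auto
  next
    case False
    then obtain i0 where i0: "i0 \<in> I" "a i0 b \<noteq> 0" by auto
    let ?I = "I - {i0}"
    let ?a = "\<lambda>i b'. a i b' - a i b / a i0 b * a i0 b'"
    have "card B < card ?I" using insert.prems insert.hyps i0 by auto
    with insert.IH[of ?I ?a] insert.prems obtain c where
      c: "\<exists>i\<in>?I. c i \<noteq> 0" "\<forall>b'\<in>B. (\<Sum>i\<in>?I. c i * ?a i b') = 0" by auto
    \<comment> \<open>Equation \<open>b\<close> forces the value \<open>- ?s\<close> on the
      eliminated unknown \<open>i0\<close>.\<close>
    let ?s = "\<Sum>i\<in>?I. c i * (a i b / a i0 b)"
    let ?c = "\<lambda>i. if i = i0 then - ?s else c i"
    have split: "(\<Sum>i\<in>I. ?c i * a i b') = (\<Sum>i\<in>?I. c i * a i b') - ?s * a i0 b'" for b'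
    proof -
      have "(\<Sum>i\<in>I. ?c i * a i b') = ?c i0 * a i0 b' + (\<Sum>i\<in>?I. ?c i * a i b')"
        using insert.prems i0 by (intro sum.remove) auto
      also have "(\<Sum>i\<in>?I. ?c i * a i b') = (\<Sum>i\<in>?I. c i * a i b')"
        by (rule sum.cong) auto
      finally show ?thesis by simp
    qed
    have eq: "(\<Sum>i\<in>?I. c i * ?a i b') = (\<Sum>i\<in>?I. c i * a i b') - ?s * a i0 b'" for b'
      unfolding sum_distrib_right sum_subtractf[symmetric]
      by (rule sum.cong) (auto simp: algebra_simps)
    have "(\<Sum>i\<in>?I. c i * ?a i b) = 0" using i0 by simp
    then have sum0: "(\<Sum>i\<in>I. ?c i * a i b') = 0" if "b' \<in> insert b B" for b'
      using that c(2) unfolding split eq by auto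
    have "\<exists>i\<in>I. ?c i \<noteq> 0" using c(1) by auto
    then show ?thesis using sum0 by (intro exI[of _ ?c] conjI ballI)
  qed
qed

text \<open>Coefficients are indexed by the functions themselves. For infinite \<open>B\<close> the
  sum is 0 by convention, so this is the linear span only when \<open>B\<close> is finite.\<close>

definition fspan :: "('a \<Rightarrow> 'k::field) set \<Rightarrow> ('a \<Rightarrow> 'k) set" where
  "fspan B = {F. \<exists>a. F = (\<lambda>x. \<Sum>b\<in>B. a b * b x)}"

lemma fspanE:
  assumes "p \<in> fspan B" obtains a where "p = (\<lambda>x. \<Sum>b\<in>B. a b * b x)"
  using assms unfolding fspan_def by auto

lemma fspan_base: "finite B \<Longrightarrow> b \<in> B \<Longrightarrow> b \<in> fspan B"
  unfolding fspan_def mem_Collect_eq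
  by (intro exI[of _ "\<lambda>b'. if b' = b then 1 else 0"]) (simp add: if_distrib[of "\<lambda>c. c * _"] cong: if_cong)

lemma fspan_zero: "(\<lambda>x. 0) \<in> fspan B"
  unfolding fspan_def mem_Collect_eq by (intro exI[of _ "\<lambda>b. 0"]) simp

lemma fspan_add: "p \<in> fspan B \<Longrightarrow> q \<in> fspan B \<Longrightarrow> (\<lambda>x. p x + q x) \<in> fspan B"
  unfolding fspan_def mem_Collect_eq
  by (elim exE) (rule_tac x="\<lambda>b. a b + aa b" in exI, simp add: algebra_simps sum.distrib)

lemma fspan_scale: "p \<in> fspan B \<Longrightarrow> (\<lambda>x. c * p x) \<in> fspan B"
  unfolding fspan_def mem_Collect_eq
  by (elim exE) (rule_tac x="\<lambda>b. c * a b" in exI, simp add: algebra_simps sum_distrib_left)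

lemma fspan_sum: "(\<And>i. i \<in> I \<Longrightarrow> u i \<in> fspan B) \<Longrightarrow> (\<lambda>x. \<Sum>i\<in>I. u i x) \<in> fspan B"
  by (induction I rule: infinite_finite_induct) (auto intro: fspan_zero fspan_add)

lemma fspan_mono: "finite C \<Longrightarrow> B \<subseteq> C \<Longrightarrow> p \<in> fspan B \<Longrightarrow> p \<in> fspan C"
  unfolding fspan_def[of B]
  by (auto intro!: fspan_sum fspan_scale intro: fspan_base)

text \<open>Writing out the \<open>u i\<close> in terms of \<open>B\<close> turns a linear relation
  into a homogeneous system with \<open>card B\<close> equations and \<open>card B + 1\<close>
  unknowns.\<close>

lemma fspan_dependence:
  fixes B :: "('a \<Rightarrow> 'k::field) set"
  assumes "finite B" "\<And>i. i \<le> card B \<Longrightarrow> u i \<in> fspan B"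
  obtains c where "\<exists>i\<le>card B. c i \<noteq> 0" "\<And>x. (\<Sum>i\<le>card B. c i * u i x) = 0"
proof -
  have "\<forall>i. \<exists>a. i \<le> card B \<longrightarrow> u i = (\<lambda>x. \<Sum>b\<in>B. a b * b x)"
    using assms(2) unfolding fspan_def by blast
  then obtain a where a: "\<And>i. i \<le> card B \<Longrightarrow> u i = (\<lambda>x. \<Sum>b\<in>B. a i b * b x)" by metis
  obtain c where c: "\<exists>i\<le>card B. c i \<noteq> 0" "\<forall>b\<in>B. (\<Sum>i\<le>card B. c i * a i b) = 0"
    using homogeneous_system_solution[of B "{..card B}" a] assms(1) by auto
  have "(\<Sum>i\<le>card B. c i * u i x) = 0" for x
  proof -
    have "(\<Sum>i\<le>card B. c i * u i x) = (\<Sum>i\<le>card B. \<Sum>b\<in>B. c i * a i b * b x)"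
      by (intro sum.cong) (auto simp: a sum_distrib_left mult.assoc)
    also have "\<dots> = (\<Sum>b\<in>B. \<Sum>i\<le>card B. c i * a i b * b x)" by (rule sum.swap)
    also have "\<dots> = (\<Sum>b\<in>B. (\<Sum>i\<le>card B. c i * a i b) * b x)" by (simp add: sum_distrib_right)
    finally show ?thesis using c by simp
  qed
  with c show ?thesis using that by blast
qed

section \<open>Homogeneous forms and graded ideals\<close>

text \<open>Forms are functions rather than formal polynomials. The only product rule is
  multiplication by a coordinate, so induction peels off one variable at a time; general products
  follow in \<open>form_mult\<close>.\<close>

inductive is_form :: "nat \<Rightarrow> nat \<Rightarrow> ('k::field list \<Rightarrow> 'k) \<Rightarrow> bool" for m :: nat where
  const: "is_form m 0 (\<lambda>x. c)"
| zero: "is_form m d (\<lambda>x. 0)"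
| add: "is_form m d p \<Longrightarrow> is_form m d q \<Longrightarrow> is_form m d (\<lambda>x. p x + q x)"
| coord_mult: "i < m \<Longrightarrow> is_form m d p \<Longrightarrow> is_form m (Suc d) (\<lambda>x. x ! i * p x)"

definition form :: "nat \<Rightarrow> nat \<Rightarrow> ('k::field list \<Rightarrow> 'k) set" where
  "form m d = {p. is_form m d p}"

lemma is_form_iff: "is_form m d p \<longleftrightarrow> p \<in> form m d"
  by (simp add: form_def)

lemmas form_intros = is_form.intros [unfolded is_form_iff]
lemmas form_const = is_form.const [unfolded is_form_iff]
lemmas form_zero = is_form.zero [unfolded is_form_iff]
lemmas form_add = is_form.add [unfolded is_form_iff]
lemmas form_coord_mult = is_form.coord_mult [unfolded is_form_iff]
lemmas form_induct [consumes 1, case_names const zero add coord_mult, induct set: form] =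
  is_form.induct [unfolded is_form_iff]

lemma form_0_const: assumes "p \<in> form m 0" obtains c where "p = (\<lambda>x. c)"
proof -
  have "\<lbrakk>p \<in> form m d; d = 0\<rbrakk> \<Longrightarrow> \<exists>c. p = (\<lambda>x. c)" for d
    by (induction rule: form_induct) auto
  with assms that show ?thesis by blast
qed

lemma form_Suc_induct [consumes 1, case_names zero add coord_mult]:
  assumes "p \<in> form m (Suc d)" "P (\<lambda>x. 0)"
    "\<And>p q. p \<in> form m (Suc d) \<Longrightarrow> P p \<Longrightarrow> q \<in> form m (Suc d) \<Longrightarrow> P q \<Longrightarrow> P (\<lambda>x. p x + q x)"
    "\<And>i q. i < m \<Longrightarrow> q \<in> form m d \<Longrightarrow> P (\<lambda>x. x ! i * q x)"
  shows "P p"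
proof -
  have "\<lbrakk>p \<in> form m e; e = Suc d\<rbrakk> \<Longrightarrow> P p" for e
    by (induction rule: form_induct) (use assms(2-4) in auto)
  with assms(1) show ?thesis by blast
qed

lemma form_scale: "p \<in> form m d \<Longrightarrow> (\<lambda>x. c * p x) \<in> form m d"
proof (induction rule: form_induct)
  case (add d p q)
  from form_add[OF add.IH] show ?case by (simp add: algebra_simps)
next
  case (coord_mult i d p)
  from form_coord_mult[OF coord_mult.hyps(1) coord_mult.IH] show ?case by (simp add: algebra_simps)
qed (auto intro: form_intros)

lemma form_mult:
  assumes "q \<in> form m e"
  shows "p \<in> form m d \<Longrightarrow> (\<lambda>x. p x * q x) \<in> form m (d + e)"
proof (induction rule: form_induct)
  case (add d p q)
  from form_add[OF add.IH] show ?case by (simp add: algebra_simps)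
next
  case (coord_mult i d p)
  from form_coord_mult[OF coord_mult.hyps(1) coord_mult.IH] show ?case by (simp add: algebra_simps)
qed (auto intro: form_intros form_scale assms)

lemma form_coord: "i < m \<Longrightarrow> (\<lambda>x. x ! i) \<in> form m (Suc 0)"
  using form_coord_mult[OF _ form_const, of i m 1] by simp

lemma form_power: "p \<in> form m d \<Longrightarrow> (\<lambda>x. p x ^ k) \<in> form m (k * d)"
  by (induction k) (auto intro: form_const form_mult)

lemma form_coord_power: "i < m \<Longrightarrow> (\<lambda>x. (x ! i) ^ k) \<in> form m k"
  using form_power[OF form_coord, of i m k] by simp

lemma form_sum: "(\<And>i. i \<in> I \<Longrightarrow> u i \<in> form m d) \<Longrightarrow> (\<lambda>x. \<Sum>i\<in>I. u i x) \<in> form m d"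
  by (induction I rule: infinite_finite_induct) (auto intro: form_intros)

definition matvec :: "nat \<Rightarrow> (nat \<Rightarrow> nat \<Rightarrow> 'k::field) \<Rightarrow> 'k list \<Rightarrow> 'k list" where
  "matvec m A x = map (\<lambda>i. \<Sum>j<m. A i j * x ! j) [0..<m]"

lemma length_matvec [simp]: "length (matvec m A x) = m"
  by (simp add: matvec_def)

lemma nth_matvec [simp]: "i < m \<Longrightarrow> matvec m A x ! i = (\<Sum>j<m. A i j * x ! j)"
  by (simp add: matvec_def)

text \<open>A linear substitution replaces each coordinate by a linear form and so keeps degrees;
  hence the group acts on homogeneous ideals degree by degree.\<close>

lemma form_matvec: "p \<in> form m d \<Longrightarrow> (\<lambda>x. p (matvec m A x)) \<in> form m d"
proof (induction rule: form_induct)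
  case (coord_mult i d p)
  have "(\<lambda>x. matvec m A x ! i) \<in> form m (Suc 0)"
    using coord_mult.hyps by (auto intro!: form_sum form_scale form_coord)
  from form_mult[OF coord_mult.IH this] show ?case by simp
qed (auto intro: form_intros)

lemma form_at_zero: "p \<in> form m d \<Longrightarrow> d > 0 \<Longrightarrow> p (replicate m 0) = 0"
  by (induction rule: form_induct) auto

text \<open>Multiplying a spanning set of degree \<open>d\<close> by all coordinates spans degree
  \<open>d + 1\<close>. Finiteness is all that is used later, so no monomial basis is built.\<close>

lemma form_finite_span:
  "\<exists>B :: ('k::field list \<Rightarrow> 'k) set. finite B \<and> B \<subseteq> form m d \<and> form m d \<subseteq> fspan B"
proof (induction d)
  case 0
  have "p \<in> fspan {\<lambda>x. 1}" if p: "p \<in> form m 0" for p :: "'k list \<Rightarrow> 'k"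
  proof -
    obtain c where "p = (\<lambda>x. c)" by (rule form_0_const[OF p])
    then show ?thesis unfolding fspan_def by (auto intro!: exI[of _ "\<lambda>_. c"])
  qed
  then show ?case by (intro exI[of _ "{\<lambda>x. 1}"]) (auto intro: form_const)
next
  case (Suc d)
  then obtain B :: "('k list \<Rightarrow> 'k) set" where B: "finite B" "B \<subseteq> form m d" "form m d \<subseteq> fspan B"
    by (elim exE conjE)
  define C where "C = (\<lambda>(i, b). \<lambda>x. x ! i * b x) ` ({..<m} \<times> B)"
  have fin: "finite C" using B by (simp add: C_def)
  have "p \<in> fspan C" if "p \<in> form m (Suc d)" for p
    using that
  proof (induction rule: form_Suc_induct)
    case (coord_mult i q)
    have "q \<in> fspan B" using B(3) coord_mult(2) by (rule subsetD)
    then obtain a where a: "q = (\<lambda>x. \<Sum>b\<in>B. a b * b x)" by (rule fspanE)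
    have "(\<lambda>x. \<Sum>b\<in>B. a b * (x ! i * b x)) \<in> fspan C"
      using coord_mult(1) fin by (auto intro!: fspan_sum fspan_scale fspan_base simp: C_def)
    then show ?case by (simp add: a sum_distrib_left algebra_simps)
  qed (auto intro: fspan_zero fspan_add)
  with fin B show ?case by (intro exI[of _ C]) (auto simp: C_def intro: form_coord_mult)
qed

text \<open>Properness excludes all powers of the irrelevant ideal, not just the unit ideal. The degree is kept
  next to each form because the zero function has every degree.\<close>

definition graded_ideal :: "nat \<Rightarrow> (nat \<times> ('k::field list \<Rightarrow> 'k)) set \<Rightarrow> bool" where
  "graded_ideal m I \<longleftrightarrow>
     (\<forall>d p. (d, p) \<in> I \<longrightarrow> p \<in> form m d) \<and> (\<forall>d. (d, \<lambda>x. 0) \<in> I) \<and>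
     (\<forall>d p q. (d, p) \<in> I \<and> (d, q) \<in> I \<longrightarrow> (d, \<lambda>x. p x + q x) \<in> I) \<and>
     (\<forall>d e p q. (d, p) \<in> I \<and> q \<in> form m e \<longrightarrow> (d + e, \<lambda>x. p x * q x) \<in> I)"

definition proper_ideal :: "nat \<Rightarrow> (nat \<times> ('k::field list \<Rightarrow> 'k)) set \<Rightarrow> bool" where
  "proper_ideal m I \<longleftrightarrow> (\<forall>d. \<exists>p\<in>form m d. (d, p) \<notin> I)"

text \<open>The set of substitutions is a parameter: the empty set admits every graded ideal, as the
  Nullstellensatz wants, and the maps \<open>act h\<close> give the \<open>H\<close>-stable
  ideals.\<close>

definition stable_ideal :: "('k list \<Rightarrow> 'k list) set \<Rightarrow> (nat \<times> ('k list \<Rightarrow> 'k)) set \<Rightarrow> bool" where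
  "stable_ideal \<Phi> I \<longleftrightarrow> (\<forall>\<phi>\<in>\<Phi>. \<forall>(d, p)\<in>I. (d, \<lambda>x. p (\<phi> x)) \<in> I)"

lemma
  assumes "graded_ideal m I"
  shows graded_ideal_form: "(d, p) \<in> I \<Longrightarrow> p \<in> form m d"
    and graded_ideal_zero: "(d, \<lambda>x. 0) \<in> I"
    and graded_ideal_add: "(d, p) \<in> I \<Longrightarrow> (d, q) \<in> I \<Longrightarrow> (d, \<lambda>x. p x + q x) \<in> I"
    and graded_ideal_mult: "(d, p) \<in> I \<Longrightarrow> q \<in> form m e \<Longrightarrow> (d + e, \<lambda>x. p x * q x) \<in> I"
  using assms unfolding graded_ideal_def by blast+

lemma graded_ideal_scale: "graded_ideal m I \<Longrightarrow> (d, p) \<in> I \<Longrightarrow> (d, \<lambda>x. c * p x) \<in> I"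
  using graded_ideal_mult[of m I d p "\<lambda>x. c" 0] by (simp add: form_const mult.commute)

lemma graded_ideal_sum:
  assumes "graded_ideal m I"
  shows "(\<And>i. i \<in> A \<Longrightarrow> (d, u i) \<in> I) \<Longrightarrow> (d, \<lambda>x. \<Sum>i\<in>A. u i x) \<in> I"
  by (induction A rule: infinite_finite_induct) (auto intro: graded_ideal_zero[OF assms] graded_ideal_add[OF assms])

lemma graded_ideal_diff: "graded_ideal m I \<Longrightarrow> (d, p) \<in> I \<Longrightarrow> (d, q) \<in> I \<Longrightarrow> (d, \<lambda>x. p x - q x) \<in> I"
  using graded_ideal_add[of m I d p "\<lambda>x. - 1 * q x"] graded_ideal_scale[of m I d q "- 1"] by simp

text \<open>Forms of degree \<open>d + 1\<close> are sums of coordinate multiples of forms of degree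
  \<open>d\<close>, so an ideal that fills one degree fills all later ones.\<close>

lemma improper_mono:
  assumes "graded_ideal m I" "\<forall>p\<in>form m d. (d, p) \<in> I" "d \<le> e"
  shows "\<forall>p\<in>form m e. (e, p) \<in> I"
  using assms(3)
proof (induction e rule: dec_induct)
  case (step e)
  have "(Suc e, p) \<in> I" if "p \<in> form m (Suc e)" for p
    using that
  proof (induction rule: form_Suc_induct)
    case (coord_mult i q)
    then show ?case
      using graded_ideal_mult[OF assms(1), of e q "\<lambda>x. x ! i" "Suc 0"] step.IH by (simp add: form_coord mult.commute)
  qed (auto intro: graded_ideal_zero[OF assms(1)] graded_ideal_add[OF assms(1)])
  then show ?case by blast
qed (rule assms(2))

text \<open>Zorn's lemma. Properness survives unions of chains because the forms of degree
  \<open>d\<close> are spanned by finitely many: if the union contained them all, one member of the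
  chain would already contain the generators.\<close>

lemma exists_maximal_ideal:
  assumes I0: "graded_ideal m I0" "proper_ideal m I0" "stable_ideal \<Phi> I0"
  obtains I where "graded_ideal m I" "proper_ideal m I" "stable_ideal \<Phi> I" "I0 \<subseteq> I"
    "\<And>J. graded_ideal m J \<Longrightarrow> proper_ideal m J \<Longrightarrow> stable_ideal \<Phi> J \<Longrightarrow> I \<subseteq> J \<Longrightarrow> J = I"
proof -
  define S where "S = {I. graded_ideal m I \<and> proper_ideal m I \<and> stable_ideal \<Phi> I \<and> I0 \<subseteq> I}"
  have "\<Union>\<C> \<in> S" if ne: "\<C> \<noteq> {}" and ch: "subset.chain S \<C>" for \<C>
  proof -
    have sub: "\<C> \<subseteq> S" and lin: "\<And>A B. A \<in> \<C> \<Longrightarrow> B \<in> \<C> \<Longrightarrow> A \<subseteq> B \<or> B \<subseteq> A"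
      using ch unfolding subset.chain_def by blast+
    have gi: "graded_ideal m A" if "A \<in> \<C>" for A using that sub by (auto simp: S_def)
    have U: "graded_ideal m (\<Union>\<C>)"
      unfolding graded_ideal_def
    proof (intro conjI allI impI)
      fix d :: nat and p q :: "'a list \<Rightarrow> 'a"
      assume "(d, p) \<in> \<Union>\<C> \<and> (d, q) \<in> \<Union>\<C>"
      then obtain A B where "A \<in> \<C>" "B \<in> \<C>" "(d, p) \<in> A" "(d, q) \<in> B" by blast
      then obtain C where "C \<in> \<C>" "(d, p) \<in> C" "(d, q) \<in> C" using lin by blast
      then show "(d, \<lambda>x. p x + q x) \<in> \<Union>\<C>" using graded_ideal_add[OF gi, of C d p q] by blast
    next
      fix d show "(d, \<lambda>x. 0) \<in> \<Union>\<C>" using ne graded_ideal_zero[OF gi] by blast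
    next
      fix d and p :: "'a list \<Rightarrow> 'a" assume "(d, p) \<in> \<Union>\<C>"
      then show "p \<in> form m d" using graded_ideal_form[OF gi] by blast
    next
      fix d e and p q :: "'a list \<Rightarrow> 'a" assume "(d, p) \<in> \<Union>\<C> \<and> q \<in> form m e"
      then obtain A where "A \<in> \<C>" "(d, p) \<in> A" "q \<in> form m e" by blast
      then show "(d + e, \<lambda>x. p x * q x) \<in> \<Union>\<C>" using graded_ideal_mult[OF gi] by blast
    qed
    have "proper_ideal m (\<Union>\<C>)"
      unfolding proper_ideal_def
    proof (rule ccontr)
      assume "\<not> (\<forall>d. \<exists>p\<in>form m d. (d, p) \<notin> \<Union>\<C>)"
      then obtain d where d: "\<forall>p\<in>form m d. (d, p) \<in> \<Union>\<C>" by blast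
      obtain B :: "('a list \<Rightarrow> 'a) set" where B: "finite B" "B \<subseteq> form m d" "form m d \<subseteq> fspan B"
        using form_finite_span by meson
      have "Pair d ` B \<subseteq> \<Union>\<C>" using d B by blast
      then obtain A where A: "A \<in> \<C>" "Pair d ` B \<subseteq> A"
        using finite_subset_Union_chain[OF finite_imageI[OF B(1)] _ ne ch] by blast
      have "(d, p) \<in> A" if p: "p \<in> form m d" for p
      proof -
        obtain a where "p = (\<lambda>x. \<Sum>b\<in>B. a b * b x)" by (rule fspanE[OF subsetD[OF B(3) p]])
        then show ?thesis using A by (auto intro!: graded_ideal_sum[OF gi] graded_ideal_scale[OF gi])
      qed
      moreover have "proper_ideal m A" using A sub by (auto simp: S_def)
      ultimately show False unfolding proper_ideal_def by blast
    qed
    moreover have "stable_ideal \<Phi> (\<Union>\<C>)"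
      using sub unfolding S_def stable_ideal_def by fast
    moreover have "I0 \<subseteq> \<Union>\<C>" using sub ne unfolding S_def by blast
    ultimately show ?thesis using U by (simp add: S_def)
  qed
  moreover have "I0 \<in> S" using I0 by (simp add: S_def)
  ultimately obtain I where I: "I \<in> S" "\<forall>X\<in>S. I \<subseteq> X \<longrightarrow> X = I"
    using subset_Zorn_nonempty[of S] by auto
  show ?thesis
  proof (rule that[of I])
    fix J assume J: "graded_ideal m J" "proper_ideal m J" "stable_ideal \<Phi> J" "I \<subseteq> J"
    moreover have "I0 \<subseteq> J" using I(1) J(4) by (auto simp: S_def)
    ultimately have "J \<in> S" by (simp add: S_def)
    with I(2) J(4) show "J = I" by simp
  qed (use I(1) in \<open>simp_all add: S_def\<close>)
qed

section \<open>The homogeneous Nullstellensatz\<close>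

text \<open>The possible cofactors of a form of degree \<open>e\<close> in degree \<open>d\<close>.
  The case \<open>d < e\<close> is separate because truncated subtraction would otherwise admit
  constants.\<close>

definition shifted_form :: "nat \<Rightarrow> nat \<Rightarrow> nat \<Rightarrow> ('k::field list \<Rightarrow> 'k) set" where
  "shifted_form m e d = (if e \<le> d then form m (d - e) else {\<lambda>x. 0})"

text \<open>For a graded ideal \<open>I\<close> and a form \<open>b\<close> of degree
  \<open>e\<close> this is the ideal \<open>I + (b)\<close>, described degree by degree.\<close>

definition adjoin :: "nat \<Rightarrow> (nat \<times> ('k::field list \<Rightarrow> 'k)) set \<Rightarrow> nat \<Rightarrow> ('k list \<Rightarrow> 'k)
    \<Rightarrow> (nat \<times> ('k list \<Rightarrow> 'k)) set" where
  "adjoin m I e b = {(d, F). \<exists>p q. (d, p) \<in> I \<and> q \<in> shifted_form m e d \<and> F = (\<lambda>x. p x + q x * b x)}"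

lemma shifted_form_zero: "(\<lambda>x. 0) \<in> shifted_form m e d"
  by (simp add: shifted_form_def form_zero)

lemma shifted_form_add:
  "p \<in> shifted_form m e d \<Longrightarrow> q \<in> shifted_form m e d \<Longrightarrow> (\<lambda>x. p x + q x) \<in> shifted_form m e d"
  by (auto simp: shifted_form_def form_add split: if_splits)

lemma shifted_form_mult:
  assumes "p \<in> shifted_form m e d" "q \<in> form m k"
  shows "(\<lambda>x. p x * q x) \<in> shifted_form m e (d + k)"
  using assms form_mult[of q m k p "d - e"] by (auto simp: shifted_form_def form_zero split: if_splits)

lemma shifted_form_mult_form:
  assumes "q \<in> shifted_form m e d" "b \<in> form m e"
  shows "(\<lambda>x. q x * b x) \<in> form m d"
  using assms form_mult[of b m e q "d - e"] by (auto simp: shifted_form_def form_zero split: if_splits)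

lemma adjoinI:
  "(d, p) \<in> I \<Longrightarrow> q \<in> shifted_form m e d \<Longrightarrow> F = (\<lambda>x. p x + q x * b x) \<Longrightarrow> (d, F) \<in> adjoin m I e b"
  unfolding adjoin_def by auto

lemma adjoinE:
  assumes "(d, F) \<in> adjoin m I e b"
  obtains p q where "(d, p) \<in> I" "q \<in> shifted_form m e d" "F = (\<lambda>x. p x + q x * b x)"
  using assms unfolding adjoin_def by auto

lemma graded_ideal_adjoin:
  assumes I: "graded_ideal m I" and b: "b \<in> form m e"
  shows "graded_ideal m (adjoin m I e b)"
  unfolding graded_ideal_def
proof (intro conjI allI impI; (elim conjE)?)
  fix d and p :: "'a list \<Rightarrow> 'a" assume "(d, p) \<in> adjoin m I e b"
  then show "p \<in> form m d"
    by (rule adjoinE) (simp add: form_add graded_ideal_form[OF I] shifted_form_mult_form[OF _ b])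
next
  fix d show "(d, \<lambda>x. 0) \<in> adjoin m I e b"
    by (rule adjoinI[OF graded_ideal_zero[OF I] shifted_form_zero]) simp
next
  fix d and p q :: "'a list \<Rightarrow> 'a"
  assume p: "(d, p) \<in> adjoin m I e b" and q: "(d, q) \<in> adjoin m I e b"
  obtain p1 q1 where p1: "(d, p1) \<in> I" "q1 \<in> shifted_form m e d" "p = (\<lambda>x. p1 x + q1 x * b x)"
    by (rule adjoinE[OF p])
  obtain p2 q2 where q2: "(d, p2) \<in> I" "q2 \<in> shifted_form m e d" "q = (\<lambda>x. p2 x + q2 x * b x)"
    by (rule adjoinE[OF q])
  show "(d, \<lambda>x. p x + q x) \<in> adjoin m I e b"
    by (rule adjoinI[OF graded_ideal_add[OF I p1(1) q2(1)] shifted_form_add[OF p1(2) q2(2)]])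
       (simp add: p1 q2 algebra_simps)
next
  fix d k and p q :: "'a list \<Rightarrow> 'a"
  assume p: "(d, p) \<in> adjoin m I e b" and q: "q \<in> form m k"
  obtain p1 q1 where p1: "(d, p1) \<in> I" "q1 \<in> shifted_form m e d" "p = (\<lambda>x. p1 x + q1 x * b x)"
    by (rule adjoinE[OF p])
  show "(d + k, \<lambda>x. p x * q x) \<in> adjoin m I e b"
    by (rule adjoinI[OF graded_ideal_mult[OF I p1(1) q] shifted_form_mult[OF p1(2) q]])
       (simp add: p1 algebra_simps)
qed

lemma adjoin_superset: "I \<subseteq> adjoin m I e b"
  by (auto intro!: adjoinI[OF _ shifted_form_zero])

lemma adjoin_generator: "graded_ideal m I \<Longrightarrow> (e, b) \<in> adjoin m I e b"
  by (rule adjoinI[where q = "\<lambda>x. 1", OF graded_ideal_zero]) (auto simp: shifted_form_def intro: form_const)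

text \<open>For \<open>degree p\<close> \<le> \<open>L\<close> this is \<open>p\<close> evaluated at
  the quotient of \<open>x ! j\<close> by \<open>x ! k\<close>, with denominators cleared by
  \<open>x ! k ^ L\<close>. \<open>L\<close> may exceed the degree.\<close>

definition homogenization :: "'k::field poly \<Rightarrow> nat \<Rightarrow> nat \<Rightarrow> nat \<Rightarrow> 'k list \<Rightarrow> 'k" where
  "homogenization p L j k x = (\<Sum>i\<le>L. coeff p i * (x ! j) ^ i * (x ! k) ^ (L - i))"

lemma homogenization_form:
  assumes "j < m" "k < m"
  shows "homogenization p L j k \<in> form m L"
proof -
  have "(\<lambda>x. \<Sum>i\<le>L. coeff p i * ((x ! j) ^ i * (x ! k) ^ (L - i))) \<in> form m L"
  proof (intro form_sum form_scale)
    fix i assume "i \<in> {..L}"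
    then show "(\<lambda>x. x ! j ^ i * x ! k ^ (L - i)) \<in> form m L"
      using form_mult[OF form_coord_power[OF assms(2), of "L - i"] form_coord_power[OF assms(1), of i]] by simp
  qed
  then show ?thesis by (simp add: homogenization_def[abs_def] mult.assoc)
qed

text \<open>The product splits into \<open>pCons 0 q\<close> and \<open>- c\<close> times
  \<open>q\<close>. Shifting the index in the first sum releases a factor \<open>x ! j\<close>; in
  the second the top term vanishes by the degree bound, so a factor \<open>x ! k\<close> comes
  out.\<close>

lemma homogenization_linear_factor:
  assumes "degree q \<le> L"
  shows "homogenization ([:- c, 1:] * q) (Suc L) j k x = (x ! j - c * x ! k) * homogenization q L j k x"
proof -
  let ?y = "x ! j" and ?f = "x ! k"
  have "homogenization ([:- c, 1:] * q) (Suc L) j k x =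
      (\<Sum>i\<le>Suc L. coeff (pCons 0 q) i * ?y ^ i * ?f ^ (Suc L - i))
      - c * (\<Sum>i\<le>Suc L. coeff q i * ?y ^ i * ?f ^ (Suc L - i))"
    by (simp only: homogenization_def sum_distrib_left sum_subtractf[symmetric])
       (rule sum.cong, auto simp: algebra_simps)
  also have "(\<Sum>i\<le>Suc L. coeff (pCons 0 q) i * ?y ^ i * ?f ^ (Suc L - i)) = ?y * homogenization q L j k x"
    by (simp add: sum.atMost_Suc_shift homogenization_def sum_distrib_left algebra_simps del: sum.atMost_Suc)
  also have "(\<Sum>i\<le>Suc L. coeff q i * ?y ^ i * ?f ^ (Suc L - i)) = ?f * homogenization q L j k x"
    using assms by (auto simp: coeff_eq_0 homogenization_def sum_distrib_left Suc_diff_le algebra_simps intro!: sum.cong)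
  finally show ?thesis by (simp add: algebra_simps)
qed

text \<open>Maximality is among all proper graded ideals, without stability. Over an algebraically
  closed field such a \<open>P\<close> is the ideal of a point of projective space.\<close>

locale maximal_graded_ideal =
  fixes m :: nat and P :: "(nat \<times> ('k::field list \<Rightarrow> 'k)) set"
  assumes gi: "graded_ideal m P" and proper: "proper_ideal m P"
    and maximal: "graded_ideal m J \<Longrightarrow> proper_ideal m J \<Longrightarrow> P \<subseteq> J \<Longrightarrow> J = P"
begin

text \<open>By maximality \<open>P + (b)\<close> fills some degree, hence by
  \<open>improper_mono\<close> all later ones.\<close>

lemma adjoin_improper:
  assumes "b \<in> form m e" "(e, b) \<notin> P"
  obtains N where "\<And>d p. d \<ge> N \<Longrightarrow> p \<in> form m d \<Longrightarrow> (d, p) \<in> adjoin m P e b"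
proof -
  note gj = graded_ideal_adjoin[OF gi assms(1)]
  have "\<not> proper_ideal m (adjoin m P e b)"
    using maximal[OF gj _ adjoin_superset] adjoin_generator[OF gi, of e b] assms(2) by metis
  then obtain N where "\<forall>p\<in>form m N. (N, p) \<in> adjoin m P e b"
    unfolding proper_ideal_def by blast
  then show ?thesis using improper_mono[OF gj] that by blast
qed

text \<open>If \<open>b \<notin> P\<close>, the colon ideal \<open>(P : b)\<close> is still proper, hence equal to \<open>P\<close>.\<close>

lemma prime:
  assumes a: "a \<in> form m r" and b: "b \<in> form m e" and ab: "(r + e, \<lambda>x. a x * b x) \<in> P"
  shows "(r, a) \<in> P \<or> (e, b) \<in> P"
proof (rule disjCI)
  assume nb: "(e, b) \<notin> P"
  define C where "C = {(d, F). F \<in> form m d \<and> (d + e, \<lambda>x. F x * b x) \<in> P}"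
  have C: "graded_ideal m C"
    unfolding graded_ideal_def
  proof (intro conjI allI impI; (elim conjE)?)
    fix d show "(d, \<lambda>x. 0) \<in> C" using graded_ideal_zero[OF gi] by (simp add: C_def form_zero)
  next
    fix d k and p q :: "'k list \<Rightarrow> 'k" assume "(d, p) \<in> C" "q \<in> form m k"
    then show "(d + k, \<lambda>x. p x * q x) \<in> C"
      using graded_ideal_mult[OF gi, of "d + e" "\<lambda>x. p x * b x" q k] form_mult[of q m k p d]
      by (simp add: C_def algebra_simps)
  next
    fix d and p q :: "'k list \<Rightarrow> 'k" assume "(d, p) \<in> C" "(d, q) \<in> C"
    then show "(d, \<lambda>x. p x + q x) \<in> C"
      using graded_ideal_add[OF gi, of "d + e" "\<lambda>x. p x * b x" "\<lambda>x. q x * b x"]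
      by (simp add: C_def form_add algebra_simps)
  qed (simp add: C_def)
  have sub: "P \<subseteq> C"
    using graded_ideal_mult[OF gi _ b] graded_ideal_form[OF gi] by (auto simp: C_def)
  have "proper_ideal m C"
    unfolding proper_ideal_def
  proof (rule ccontr)
    assume "\<not> (\<forall>d. \<exists>p\<in>form m d. (d, p) \<notin> C)"
    then obtain N where N: "\<forall>p\<in>form m N. (N, p) \<in> C" by blast
    obtain N' where N': "\<And>d p. d \<ge> N' \<Longrightarrow> p \<in> form m d \<Longrightarrow> (d, p) \<in> adjoin m P e b"
      using adjoin_improper[OF b nb] by blast
    \<comment> \<open>In degree \<open>M\<close> every form splits as \<open>s + t * b\<close> with
      \<open>s\<close> in \<open>P\<close>, and the cofactor \<open>t\<close> has degree
      \<open>N' + N\<close>, high enough to lie in \<open>C\<close>; then \<open>t * b\<close> is in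
      \<open>P\<close> too.\<close>
    define M where "M = N' + N + e"
    have "(M, p) \<in> P" if "p \<in> form m M" for p
    proof -
      have "(M, p) \<in> adjoin m P e b" using N'[of M p] that by (simp add: M_def)
      then obtain s t where st: "(M, s) \<in> P" "t \<in> shifted_form m e M" "p = (\<lambda>x. s x + t x * b x)"
        by (rule adjoinE)
      then have "(N' + N, t) \<in> C" using improper_mono[OF C N, of "N' + N"] by (simp add: shifted_form_def M_def)
      then have "(M, \<lambda>x. t x * b x) \<in> P" by (simp add: C_def M_def)
      with st(1) show ?thesis unfolding st(3) by (rule graded_ideal_add[OF gi])
    qed
    with proper show False unfolding proper_ideal_def by blast
  qed
  from maximal[OF C this sub] show "(r, a) \<in> P" using a ab by (auto simp: C_def)
qed

lemma const_notin: "c \<noteq> 0 \<Longrightarrow> (0, \<lambda>x. c) \<notin> P"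
proof
  assume c: "c \<noteq> 0" "(0, \<lambda>x. c) \<in> P"
  have "(0, p) \<in> P" if p: "p \<in> form m 0" for p
  proof -
    obtain a where "p = (\<lambda>x. a)" by (rule form_0_const[OF p])
    then show ?thesis using graded_ideal_scale[OF gi c(2), of "a / c"] c(1) by simp
  qed
  with proper show False unfolding proper_ideal_def by blast
qed

lemma power_notin:
  assumes "f \<in> form m 1" "(1, f) \<notin> P"
  shows "(k, \<lambda>x. f x ^ k) \<notin> P"
proof (induction k)
  case 0
  then show ?case using const_notin[of 1] by simp
next
  case (Suc k)
  then show ?case
    using prime[OF assms(1), of "\<lambda>x. f x ^ k" k] form_power[OF assms(1), of k] assms(2) by auto
qed

text \<open>Induction on \<open>degree p\<close>: a root of \<open>p\<close> splits off a linear
  factor, and by primality either that factor or the homogenized cofactor lies in \<open>P\<close>.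
  A nonzero constant \<open>p\<close> would put a power of \<open>x ! k\<close> in
  \<open>P\<close>.\<close>

lemma linear_factor:
  assumes alg: "alg_closed_field TYPE('k)" and jk: "j < m" "k < m" and k: "(1, \<lambda>x. x ! k) \<notin> P"
  shows "p \<noteq> 0 \<Longrightarrow> degree p \<le> L \<Longrightarrow> (L, homogenization p L j k) \<in> P \<Longrightarrow>
    \<exists>c. (1, \<lambda>x. x ! j - c * x ! k) \<in> P"
proof (induction "degree p" arbitrary: p L)
  case 0
  then obtain c where c: "p = [:c:]" using degree_eq_zeroE by metis
  have "homogenization p L j k x = (\<Sum>i\<le>L. if i = 0 then c * x ! k ^ L else 0)" for x
    unfolding homogenization_def by (rule sum.cong) (auto simp: c coeff_pCons split: nat.splits)
  then have eq: "homogenization p L j k = (\<lambda>x. c * x ! k ^ L)" by auto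
  have "(L, \<lambda>x. inverse c * (c * x ! k ^ L)) \<in> P"
    using graded_ideal_scale[OF gi "0.prems"(3)] by (simp add: eq)
  moreover have "c \<noteq> 0" using "0.prems"(1) c by simp
  ultimately have "(L, \<lambda>x. x ! k ^ L) \<in> P" by (simp flip: mult.assoc)
  then show ?case using power_notin[of "\<lambda>x. x ! k" L] k jk form_coord by auto
next
  case (Suc e)
  then obtain c where "poly p c = 0" using alg unfolding alg_closed_field_def by (metis zero_less_Suc)
  then obtain q where q: "p = [:- c, 1:] * q" using poly_eq_0_iff_dvd by blast
  with Suc.prems have q0: "q \<noteq> 0" by auto
  then have dq: "degree p = Suc (degree q)" unfolding q by (subst degree_mult_eq) auto
  with Suc.prems obtain L' where L': "L = Suc L'" "degree q \<le> L'" by (cases L) auto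
  have lin: "(\<lambda>x. x ! j - c * x ! k) \<in> form m 1"
    using form_add[OF form_coord form_scale[OF form_coord], OF jk, of "- c"] by simp
  have "homogenization p L j k = (\<lambda>x. (x ! j - c * x ! k) * homogenization q L' j k x)"
    unfolding q L'(1) by (rule ext) (rule homogenization_linear_factor[OF L'(2)])
  with Suc.prems(3) have "(1 + L', \<lambda>x. (x ! j - c * x ! k) * homogenization q L' j k x) \<in> P"
    by (simp add: L'(1))
  from prime[OF lin homogenization_form[OF jk] this]
  show ?case using Suc.hyps(1)[of q L'] Suc.hyps(2) dq q0 L' by auto
qed

text \<open>For a coordinate \<open>f = x\<^sub>k\<close> outside \<open>P\<close>, the ideal \<open>P + (f)\<close> is improper, so modulo \<open>P\<close> every form of
  degree \<open>N + n\<close> is \<open>f\<^sup>n\<close> times a form of degree \<open>N\<close>. By dimension, some binary form in \<open>x\<^sub>j\<close> and \<open>f\<close> lies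
  in \<open>P\<close>; it splits into linear factors, so \<open>x\<^sub>j - c\<^sub>j f\<close> lies in \<open>P\<close>, and \<open>c\<close> is the zero.\<close>

lemma exists_zero:
  assumes alg: "alg_closed_field TYPE('k)"
  obtains v where "length v = m" "v \<noteq> replicate m 0" "\<And>d p. (d, p) \<in> P \<Longrightarrow> p v = 0"
proof -
  \<comment> \<open>Otherwise \<open>P\<close> would contain every linear form and fill degree
    1.\<close>
  have "\<exists>k<m. (1, \<lambda>x. x ! k) \<notin> P"
  proof (rule ccontr)
    assume no: "\<not> (\<exists>k<m. (1, \<lambda>x. x ! k) \<notin> P)"
    have "(1, p) \<in> P" if "p \<in> form m (Suc 0)" for p
      using that
    proof (induction rule: form_Suc_induct)
      case (coord_mult i q)
      obtain c where c: "q = (\<lambda>x. c)" by (rule form_0_const[OF coord_mult(2)])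
      show ?case using graded_ideal_scale[OF gi, of 1 "\<lambda>x. x ! i" c] no coord_mult(1) by (simp add: c mult.commute)
    qed (auto intro: graded_ideal_zero[OF gi] graded_ideal_add[OF gi])
    with proper show False unfolding proper_ideal_def by (metis One_nat_def)
  qed
  then obtain k where k: "k < m" "(1, \<lambda>x. x ! k) \<notin> P" by blast
  have fk: "(\<lambda>x. x ! k) \<in> form m 1" using form_coord[OF k(1)] by simp
  obtain N where N: "\<And>d p. d \<ge> N \<Longrightarrow> p \<in> form m d \<Longrightarrow> (d, p) \<in> adjoin m P 1 (\<lambda>x. x ! k)"
    using adjoin_improper[OF fk k(2)] by blast
  have reduce: "\<exists>s t. (N + n, s) \<in> P \<and> t \<in> form m N \<and> p = (\<lambda>x. s x + t x * x ! k ^ n)"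
    if "p \<in> form m (N + n)" for n p
    using that
  proof (induction n arbitrary: p)
    case 0
    then show ?case using graded_ideal_zero[OF gi, of N] by (intro exI[of _ "\<lambda>x. 0"] exI[of _ p]) simp
  next
    case (Suc n)
    have "(Suc (N + n), p) \<in> adjoin m P 1 (\<lambda>x. x ! k)" using N[of "Suc (N + n)" p] Suc.prems by simp
    then obtain s t where st: "(Suc (N + n), s) \<in> P" "t \<in> shifted_form m 1 (Suc (N + n))"
      "p = (\<lambda>x. s x + t x * x ! k)" by (rule adjoinE)
    then have "t \<in> form m (N + n)" by (simp add: shifted_form_def)
    from Suc.IH[OF this] obtain s' t' where s': "(N + n, s') \<in> P" "t' \<in> form m N"
      "t = (\<lambda>x. s' x + t' x * x ! k ^ n)" by (elim exE conjE)
    have "(N + Suc n, \<lambda>x. s x + s' x * x ! k) \<in> P"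
      using graded_ideal_add[OF gi st(1)] graded_ideal_mult[OF gi s'(1) fk] by simp
    then show ?case
      by (intro exI[of _ "\<lambda>x. s x + s' x * x ! k"] exI[of _ t'] conjI s'(2)) (auto simp: st(3) s'(3) algebra_simps)
  qed
  obtain B :: "('k list \<Rightarrow> 'k) set" where B: "finite B" "form m N \<subseteq> fspan B"
    using form_finite_span[of m N] by (elim exE conjE)
  have "\<exists>c. (1, \<lambda>x. x ! j - c * x ! k) \<in> P" if j: "j < m" for j
  proof -
    \<comment> \<open>This yields \<open>card B + 1\<close> monomials of degree \<open>L\<close> in
      \<open>x ! j\<close> and \<open>x ! k\<close>, whose cofactors \<open>t i\<close> lie in the
      span of \<open>card B\<close> functions. A relation among the \<open>t i\<close> leaves a
      combination of the \<open>s i\<close>, which is in \<open>P\<close>.\<close>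
    define n where "n = card B"
    define L where "L = N + n"
    have mono: "(\<lambda>x. x ! j ^ i * x ! k ^ (L - i)) \<in> form m L" if "i \<le> n" for i
      using form_mult[OF form_coord_power[OF k(1), of "L - i"] form_coord_power[OF j, of i]] that
      by (simp add: L_def)
    define Q where "Q i s t \<longleftrightarrow> (L, s) \<in> P \<and> t \<in> form m N \<and>
        (\<lambda>x. x ! j ^ i * x ! k ^ (L - i)) = (\<lambda>x. s x + t x * x ! k ^ n)" for i s t
    have "\<exists>s t. Q i s t" if "i \<le> n" for i
      using reduce[OF mono[OF that, unfolded L_def]] unfolding Q_def L_def .
    then obtain s t where "\<And>i. i \<le> n \<Longrightarrow> Q i (s i) (t i)" by metis
    then have st: "\<And>i. i \<le> n \<Longrightarrow> (L, s i) \<in> P" "\<And>i. i \<le> n \<Longrightarrow> t i \<in> form m N"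
      "\<And>i. i \<le> n \<Longrightarrow> (\<lambda>x. x ! j ^ i * x ! k ^ (L - i)) = (\<lambda>x. s i x + t i x * x ! k ^ n)"
      unfolding Q_def by simp_all
    obtain c where c: "\<exists>i\<le>n. c i \<noteq> 0" "\<And>x. (\<Sum>i\<le>n. c i * t i x) = 0"
      using fspan_dependence[OF B(1), of t] st(2) B(2) unfolding n_def by blast
    define p where "p = (\<Sum>i\<le>n. monom (c i) i)"
    have coeff: "coeff p i = (if i \<le> n then c i else 0)" for i
      by (simp add: p_def coeff_sum)
    have "homogenization p L j k x = (\<Sum>i\<le>n. c i * s i x)" for x
    proof -
      have "homogenization p L j k x = (\<Sum>i\<le>n. c i * (x ! j ^ i * x ! k ^ (L - i)))"
        unfolding homogenization_def by (rule sum.mono_neutral_cong_right) (auto simp: coeff L_def)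
      also have "\<dots> = (\<Sum>i\<le>n. c i * s i x) + (\<Sum>i\<le>n. c i * t i x) * x ! k ^ n"
        by (auto simp: fun_cong[OF st(3)] algebra_simps sum.distrib sum_distrib_left intro!: sum.cong)
      finally show ?thesis by (simp add: c(2))
    qed
    then have "homogenization p L j k = (\<lambda>x. \<Sum>i\<le>n. c i * s i x)" by (rule ext)
    moreover have "(L, \<lambda>x. \<Sum>i\<le>n. c i * s i x) \<in> P"
      using st(1) by (intro graded_ideal_sum[OF gi] graded_ideal_scale[OF gi]) auto
    moreover have "p \<noteq> 0" using c(1) coeff by (metis coeff_0)
    moreover have "degree p \<le> L" by (rule degree_le) (simp add: coeff L_def)
    ultimately show ?thesis using linear_factor[OF alg j k(1,2), of p L] by simp
  qed
  then obtain c where c: "\<And>j. j < m \<Longrightarrow> (1, \<lambda>x. x ! j - c j * x ! k) \<in> P" by metis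
  define v where "v = map c [0..<m]"
  \<comment> \<open>Modulo \<open>P\<close> each coordinate is \<open>c i\<close> times
    \<open>x ! k\<close>, so a form is congruent to its value at \<open>v\<close> times a power of
    \<open>x ! k\<close>.\<close>
  have eval: "(d, \<lambda>x. p x - p v * x ! k ^ d) \<in> P" if "p \<in> form m d" for d p
    using that
  proof (induction rule: form_induct)
    case (add d p q)
    from graded_ideal_add[OF gi add.IH] show ?case by (simp add: algebra_simps)
  next
    case (coord_mult i d p)
    have "(Suc d, \<lambda>x. (x ! i - c i * x ! k) * p x) \<in> P"
      using graded_ideal_mult[OF gi c[OF coord_mult(1)] coord_mult(2)] by simp
    moreover have "(Suc d, \<lambda>x. c i * ((p x - p v * x ! k ^ d) * x ! k)) \<in> P"
      using graded_ideal_scale[OF gi graded_ideal_mult[OF gi coord_mult.IH fk]] by simp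
    ultimately show ?case
      using graded_ideal_add[OF gi] coord_mult(1) by (fastforce simp: v_def algebra_simps)
  qed (use graded_ideal_zero[OF gi] in auto)
  show ?thesis
  proof (rule that[of v])
    show "p v = 0" if p: "(d, p) \<in> P" for d p
    proof (rule ccontr)
      assume nz: "p v \<noteq> 0"
      have "(d, \<lambda>x. p v * x ! k ^ d) \<in> P"
        using graded_ideal_diff[OF gi p eval[OF graded_ideal_form[OF gi p]]] by simp
      from graded_ideal_scale[OF gi this, of "inverse (p v)"] have "(d, \<lambda>x. x ! k ^ d) \<in> P"
        using nz by (simp flip: mult.assoc)
      then show False using power_notin[OF fk k(2)] by blast
    qed
    \<comment> \<open>If \<open>c k\<close> were 0, the relation for \<open>j = k\<close> would put
      \<open>x ! k\<close> itself in \<open>P\<close>.\<close>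
    have "v ! k \<noteq> 0" using c[OF k(1)] k by (auto simp: v_def)
    then show "v \<noteq> replicate m 0" using k(1) by auto
  qed (simp add: v_def)
qed

end

text \<open>A zero of a maximal proper graded ideal above \<open>I\<close> is a zero of
  \<open>I\<close>.\<close>

lemma graded_nullstellensatz:
  fixes I :: "(nat \<times> ('k::field list \<Rightarrow> 'k)) set"
  assumes "alg_closed_field TYPE('k)" "graded_ideal m I" "proper_ideal m I"
  obtains v where "length v = m" "v \<noteq> replicate m 0" "\<And>d p. (d, p) \<in> I \<Longrightarrow> p v = 0"
proof -
  have st: "stable_ideal {} J" for J :: "(nat \<times> ('k list \<Rightarrow> 'k)) set"
    by (simp add: stable_ideal_def)
  obtain P where P: "graded_ideal m P" "proper_ideal m P" "I \<subseteq> P"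
    and max: "\<And>J. graded_ideal m J \<Longrightarrow> proper_ideal m J \<Longrightarrow> stable_ideal {} J \<Longrightarrow> P \<subseteq> J \<Longrightarrow> J = P"
    using exists_maximal_ideal[OF assms(2,3) st] by metis
  interpret maximal_graded_ideal m P
  proof unfold_locales
    show "J = P" if "graded_ideal m J" "proper_ideal m J" "P \<subseteq> J" for J
      using max[OF that(1,2) st that(3)] .
  qed (rule P)+
  show ?thesis using exists_zero[OF assms(1)] that P(3) by (metis subsetD)
qed

section \<open>Polynomial functions and orbit closures\<close>

text \<open>Polynomial functions of degree strictly below \<open>d\<close>: the room for the lower
  terms under a leading form of degree \<open>d\<close>. For \<open>d = 0\<close> only the zero
  function remains.\<close>

definition lowpoly :: "nat \<Rightarrow> nat \<Rightarrow> ('k::field list \<Rightarrow> 'k) set" where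
  "lowpoly m d = {p. \<exists>F. (\<forall>i. F i \<in> form m i) \<and> p = (\<lambda>x. \<Sum>i<d. F i x)}"

lemma lowpolyE:
  assumes "p \<in> lowpoly m d"
  obtains F where "\<forall>i. F i \<in> form m i" "p = (\<lambda>x. \<Sum>i<d. F i x)"
  using assms unfolding lowpoly_def by auto

lemma lowpolyI: "(\<And>i. F i \<in> form m i) \<Longrightarrow> (\<lambda>x. \<Sum>i<d. F i x) \<in> lowpoly m d"
  unfolding lowpoly_def by auto

lemma lowpoly_zero: "(\<lambda>x. 0) \<in> lowpoly m d"
  using lowpolyI[of "\<lambda>i x. 0", OF form_zero] by simp

lemma lowpoly_form:
  assumes "p \<in> form m i" "i < d"
  shows "p \<in> lowpoly m d"
proof -
  have "(\<lambda>x. \<Sum>j<d. (if j = i then p else (\<lambda>x. 0)) x) \<in> lowpoly m d"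
    by (rule lowpolyI) (simp add: assms(1) form_zero)
  also have "(\<lambda>x. \<Sum>j<d. (if j = i then p else (\<lambda>x. 0)) x) = p"
    using assms(2) by (simp add: if_distrib[of "\<lambda>f. f _"] cong: if_cong)
  finally show ?thesis .
qed

lemma lowpoly_add:
  assumes "p \<in> lowpoly m d" "q \<in> lowpoly m d"
  shows "(\<lambda>x. p x + q x) \<in> lowpoly m d"
proof -
  obtain F where F: "\<forall>i. F i \<in> form m i" "p = (\<lambda>x. \<Sum>i<d. F i x)" by (rule lowpolyE[OF assms(1)])
  obtain G where G: "\<forall>i. G i \<in> form m i" "q = (\<lambda>x. \<Sum>i<d. G i x)" by (rule lowpolyE[OF assms(2)])
  show ?thesis
    using lowpolyI[of "\<lambda>i x. F i x + G i x", OF form_add[OF F(1)[rule_format] G(1)[rule_format]]] by (simp add: F(2) G(2) sum.distrib)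
qed

lemma lowpoly_sum: "(\<And>i. i \<in> I \<Longrightarrow> u i \<in> lowpoly m d) \<Longrightarrow> (\<lambda>x. \<Sum>i\<in>I. u i x) \<in> lowpoly m d"
  by (induction I rule: infinite_finite_induct) (auto intro: lowpoly_zero lowpoly_add)

lemma lowpoly_mono: "p \<in> lowpoly m d \<Longrightarrow> d \<le> d' \<Longrightarrow> p \<in> lowpoly m d'"
  by (erule lowpolyE) (auto intro!: lowpoly_sum lowpoly_form)

lemma lowpoly_mult_form:
  assumes "p \<in> lowpoly m d" "q \<in> form m e"
  shows "(\<lambda>x. p x * q x) \<in> lowpoly m (d + e)"
proof -
  obtain F where F: "\<forall>i. F i \<in> form m i" "p = (\<lambda>x. \<Sum>i<d. F i x)" by (rule lowpolyE[OF assms(1)])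
  have "(\<lambda>x. \<Sum>i<d. F i x * q x) \<in> lowpoly m (d + e)"
    by (rule lowpoly_sum, rule lowpoly_form, rule form_mult[OF assms(2) F(1)[rule_format]]) simp
  then show ?thesis by (simp add: F(2) sum_distrib_right)
qed

lemma lowpoly_scale: "p \<in> lowpoly m d \<Longrightarrow> (\<lambda>x. c * p x) \<in> lowpoly m d"
  using lowpoly_mult_form[OF _ form_const, of p m d c] by (simp add: mult.commute)

lemma lowpoly_mult:
  assumes "p \<in> lowpoly m d" "q \<in> lowpoly m e"
  shows "(\<lambda>x. p x * q x) \<in> lowpoly m (d + e)"
proof -
  obtain G where G: "\<forall>i. G i \<in> form m i" "q = (\<lambda>x. \<Sum>i<e. G i x)" by (rule lowpolyE[OF assms(2)])
  have "(\<lambda>x. \<Sum>i<e. p x * G i x) \<in> lowpoly m (d + e)"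
    by (rule lowpoly_sum, rule lowpoly_mono[OF lowpoly_mult_form[OF assms(1) G(1)[rule_format]]]) simp
  then show ?thesis by (simp add: G(2) sum_distrib_left)
qed

lemma lowpoly_matvec:
  assumes "p \<in> lowpoly m d"
  shows "(\<lambda>x. p (matvec m A x)) \<in> lowpoly m d"
proof -
  obtain F where F: "\<forall>i. F i \<in> form m i" "p = (\<lambda>x. \<Sum>i<d. F i x)" by (rule lowpolyE[OF assms])
  show ?thesis unfolding F(2) by (rule lowpolyI) (rule form_matvec[OF F(1)[rule_format]])
qed

lemma polyfun_lowpoly: "p \<in> polyfun m \<Longrightarrow> \<exists>d. p \<in> lowpoly m d"
proof (induction rule: polyfun.induct)
  case (const c)
  show ?case by (rule exI[of _ 1], rule lowpoly_form[OF form_const]) simp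
next
  case (coord i)
  then show ?case using lowpoly_form[OF form_coord, of i m 2] by auto
next
  case (add p q)
  then obtain d e where "p \<in> lowpoly m d" "q \<in> lowpoly m e" by auto
  then have "p \<in> lowpoly m (max d e)" "q \<in> lowpoly m (max d e)" by (auto elim: lowpoly_mono)
  then show ?case by (auto intro: lowpoly_add)
qed (auto intro: lowpoly_mult)

lemma lowpoly_finite_span: "\<exists>B :: ('k::field list \<Rightarrow> 'k) set. finite B \<and> lowpoly m d \<subseteq> fspan B"
proof -
  have "\<forall>i. \<exists>B :: ('k list \<Rightarrow> 'k) set. finite B \<and> form m i \<subseteq> fspan B"
    using form_finite_span by metis
  then obtain B :: "nat \<Rightarrow> ('k list \<Rightarrow> 'k) set"
    where B: "\<And>i. finite (B i)" "\<And>i. form m i \<subseteq> fspan (B i)" by metis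
  let ?B = "\<Union>i<d. B i"
  have "p \<in> fspan ?B" if p: "p \<in> lowpoly m d" for p
  proof -
    obtain F where F: "\<forall>i. F i \<in> form m i" "p = (\<lambda>x. \<Sum>i<d. F i x)" by (rule lowpolyE[OF p])
    have "F i \<in> fspan ?B" if "i < d" for i
      using B(1) that by (intro fspan_mono[OF _ _ subsetD[OF B(2) F(1)[rule_format]]]) auto
    then show ?thesis unfolding F(2) by (intro fspan_sum) simp
  qed
  then show ?thesis using B(1) by (intro exI[of _ ?B]) auto
qed

section \<open>Polynomial functions, closed sets and irreducibility\<close>

lemma polyfun_sum: "(\<And>i. i \<in> I \<Longrightarrow> u i \<in> polyfun m) \<Longrightarrow> (\<lambda>x. \<Sum>i\<in>I. u i x) \<in> polyfun m"
  by (induction I rule: infinite_finite_induct) (auto intro: polyfun.intros)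

lemma polyfun_prod: "(\<And>i. i \<in> I \<Longrightarrow> u i \<in> polyfun m) \<Longrightarrow> (\<lambda>x. \<Prod>i\<in>I. u i x) \<in> polyfun m"
  by (induction I rule: infinite_finite_induct) (auto intro: polyfun.intros)

lemma polyfun_scale: "p \<in> polyfun m \<Longrightarrow> (\<lambda>x. c * p x) \<in> polyfun m"
  by (rule polyfun.mult[OF polyfun.const])

lemma polyfun_minus_const:
  assumes "p \<in> polyfun m" shows "(\<lambda>x. p x - c) \<in> polyfun m"
  using polyfun.add[OF assms polyfun.const[of "- c"]] by simp

lemma polyfun_mono: "p \<in> polyfun n \<Longrightarrow> n \<le> n' \<Longrightarrow> p \<in> polyfun n'"
  by (induction rule: polyfun.induct) (auto intro: polyfun.intros)

lemma polyfun_append: "p \<in> polyfun n \<Longrightarrow> length h = n \<Longrightarrow> p (h @ x) = p h"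
  by (induction rule: polyfun.induct) (auto simp: nth_append)

lemma polyfun_compose:
  assumes "\<And>i. i < m \<Longrightarrow> q i \<in> polyfun n"
  shows "p \<in> polyfun m \<Longrightarrow> (\<lambda>z. p (map (\<lambda>i. q i z) [0..<m])) \<in> polyfun n"
  by (induction rule: polyfun.induct) (auto intro: polyfun.intros assms)

lemma polyfun_matvec: "p \<in> polyfun m \<Longrightarrow> (\<lambda>x. p (matvec m A x)) \<in> polyfun m"
  unfolding matvec_def
  by (rule polyfun_compose) (auto intro!: polyfun_sum polyfun_scale polyfun.coord)

lemma zariski_closed_length: "zariski_closed n X \<Longrightarrow> x \<in> X \<Longrightarrow> length x = n"
  unfolding zariski_closed_def by auto

lemma zariski_closed_subset:
  assumes "zariski_closed n X" "F \<subseteq> polyfun n"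
  shows "zariski_closed n {x \<in> X. \<forall>f\<in>F. f x = 0}"
proof -
  obtain G where "G \<subseteq> polyfun n" "X = {x. length x = n \<and> (\<forall>f\<in>G. f x = 0)}"
    using assms(1) unfolding zariski_closed_def by blast
  then show ?thesis using assms(2) unfolding zariski_closed_def
    by (intro exI[of _ "G \<union> F"]) auto
qed

text \<open>Induction on a finite set of possible values: \<open>X\<close> is the union of the
  closed set where \<open>p = a\<close> and the closed set where \<open>p\<close> takes one of the
  other values, so one of them is all of \<open>X\<close>.\<close>

lemma irreducible_finite_image_constant:
  assumes X: "irreducible_closed n X" and p: "p \<in> polyfun n" and fin: "finite (p ` X)"
  shows "\<exists>c. \<forall>x\<in>X. p x = c"
proof -
  have cl: "zariski_closed n X"
    and irr: "\<And>Y Z. zariski_closed n Y \<Longrightarrow> zariski_closed n Z \<Longrightarrow> X = Y \<union> Z \<Longrightarrow> X = Y \<or> X = Z"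
    using X unfolding irreducible_closed_def by blast+
  have "\<lbrakk>finite A; \<forall>x\<in>X. p x \<in> A\<rbrakk> \<Longrightarrow> \<exists>c. \<forall>x\<in>X. p x = c" for A
  proof (induction A rule: finite_induct)
    case (insert a A)
    define Y where "Y = {x \<in> X. \<forall>f\<in>{\<lambda>x. p x - a}. f x = 0}"
    define Z where "Z = {x \<in> X. \<forall>f\<in>{\<lambda>x. \<Prod>c\<in>A. p x - c}. f x = 0}"
    have "zariski_closed n Y" "zariski_closed n Z"
      unfolding Y_def Z_def
      by (rule zariski_closed_subset[OF cl], simp add: polyfun_prod polyfun_minus_const p)+
    moreover have "X = Y \<union> Z"
      using insert.prems insert.hyps(1) by (auto simp: Y_def Z_def)
    ultimately consider "X = Y" | "X = Z" using irr by blast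
    then show ?case
    proof cases
      case 1
      then have "\<forall>x\<in>X. p x = a" by (auto simp: Y_def)
      then show ?thesis by blast
    next
      case 2
      then have "p x \<in> A" if "x \<in> X" for x
        using that insert.hyps(1) unfolding Z_def by (auto simp: set_eq_iff)
      then show ?thesis using insert.IH by blast
    qed
  qed auto
  from this[OF fin] show ?thesis by auto
qed

section \<open>The orbit closure of a vector as an affine variety with action\<close>

locale observable_group_rep =
  fixes H :: "'k::field list set"
    and mul :: "'k list \<Rightarrow> 'k list \<Rightarrow> 'k list"
    and ginv :: "'k list \<Rightarrow> 'k list"
    and e :: "'k list"
    and n m :: nat
    and \<rho> :: "'k list \<Rightarrow> nat \<Rightarrow> nat \<Rightarrow> 'k"
  assumes alg: "alg_closed_field TYPE('k)"
    and group: "affine_algebraic_group n H mul ginv e"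
    and irr: "irreducible_closed n H"
    and obs: "\<And>m X act. irreducible_closed m X \<Longrightarrow> regular_action n H mul e m X act
                   \<Longrightarrow> observable_action H m X act"
    and rep: "rational_rep n H mul e m \<rho>"
begin

abbreviation act :: "'k list \<Rightarrow> 'k list \<Rightarrow> 'k list" where
  "act h \<equiv> matvec m (\<rho> h)"

lemma closed_H: "zariski_closed n H"
  and e_in: "e \<in> H" and mul_in: "g \<in> H \<Longrightarrow> h \<in> H \<Longrightarrow> mul g h \<in> H"
  using group unfolding affine_algebraic_group_def by blast+

lemma irr_H: "zariski_closed n Y \<Longrightarrow> zariski_closed n Z \<Longrightarrow> H = Y \<union> Z \<Longrightarrow> H = Y \<or> H = Z"
  using irr unfolding irreducible_closed_def by blast

lemma rho_e: "i < m \<Longrightarrow> j < m \<Longrightarrow> \<rho> e i j = mat_id i j"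
  and rho_mul: "g \<in> H \<Longrightarrow> h \<in> H \<Longrightarrow> i < m \<Longrightarrow> j < m \<Longrightarrow> \<rho> (mul g h) i j = mat_mul m (\<rho> g) (\<rho> h) i j"
  using rep unfolding rational_rep_def by blast+

lemma act_e: "length x = m \<Longrightarrow> act e x = x"
  by (rule nth_equalityI)
     (auto simp: rho_e mat_id_def if_distrib[of "\<lambda>c. c * _"] cong: if_cong)

lemma act_mul:
  assumes "g \<in> H" "h \<in> H"
  shows "act (mul g h) x = act g (act h x)"
proof (rule nth_equalityI)
  fix i assume "i < length (act (mul g h) x)"
  then have i: "i < m" by simp
  have "act (mul g h) x ! i = (\<Sum>j<m. \<Sum>k<m. \<rho> g i k * \<rho> h k j * x ! j)"
    using i by (auto simp: rho_mul[OF assms] mat_mul_def sum_distrib_right intro!: sum.cong)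
  also have "\<dots> = (\<Sum>k<m. \<Sum>j<m. \<rho> g i k * \<rho> h k j * x ! j)" by (rule sum.swap)
  also have "\<dots> = act g (act h x) ! i"
    using i by (auto simp: sum_distrib_left mult.assoc intro!: sum.cong)
  finally show "act (mul g h) x ! i = act g (act h x) ! i" .
qed simp

lemma entries:
  obtains R where "\<And>i j. i < m \<Longrightarrow> j < m \<Longrightarrow> R i j \<in> polyfun n"
    "\<And>i j h. i < m \<Longrightarrow> j < m \<Longrightarrow> h \<in> H \<Longrightarrow> \<rho> h i j = R i j h"
proof -
  define Q where "Q i j p \<longleftrightarrow> p \<in> polyfun n \<and> (\<forall>h\<in>H. \<rho> h i j = p h)" for i j p
  have "\<exists>p. Q i j p" if "i < m" "j < m" for i j
  proof -
    have "\<forall>i<m. \<forall>j<m. \<exists>p\<in>polyfun n. \<forall>h\<in>H. \<rho> h i j = p h"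
      using rep by (simp add: rational_rep_def)
    then have "\<exists>p\<in>polyfun n. \<forall>h\<in>H. \<rho> h i j = p h" using that by simp
    then show ?thesis unfolding Q_def by (elim bexE) (intro exI conjI)
  qed
  then obtain R where "\<And>i j. i < m \<Longrightarrow> j < m \<Longrightarrow> Q i j (R i j)" by metis
  then show ?thesis by (intro that[of R]) (auto simp: Q_def)
qed

text \<open>The matrix entries are polynomial on \<open>H\<close>, hence so is the orbit map; this
  carries closed sets and irreducibility of \<open>H\<close> over to the orbit.\<close>

lemma orbit_pullback:
  assumes "p \<in> polyfun m"
  shows "\<exists>q\<in>polyfun n. \<forall>h\<in>H. q h = p (act h v)"
proof -
  obtain R where R: "\<And>i j. i < m \<Longrightarrow> j < m \<Longrightarrow> R i j \<in> polyfun n"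
    "\<And>i j h. i < m \<Longrightarrow> j < m \<Longrightarrow> h \<in> H \<Longrightarrow> \<rho> h i j = R i j h" by (rule entries) blast
  let ?q = "\<lambda>i h. \<Sum>j<m. R i j h * v ! j"
  have "(\<lambda>h. p (map (\<lambda>i. ?q i h) [0..<m])) \<in> polyfun n"
    by (rule polyfun_compose[OF _ assms]) (auto intro!: polyfun_sum polyfun.mult R(1) polyfun.const)
  moreover have "map (\<lambda>i. ?q i h) [0..<m] = act h v" if "h \<in> H" for h
    using that by (simp add: matvec_def R(2))
  ultimately show ?thesis by (intro bexI[of _ "\<lambda>h. p (map (\<lambda>i. ?q i h) [0..<m])"]) auto
qed

definition orbit_ideal :: "'k list \<Rightarrow> ('k list \<Rightarrow> 'k) set" where
  "orbit_ideal v = {p \<in> polyfun m. \<forall>h\<in>H. p (act h v) = 0}"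

definition orbit_closure :: "'k list \<Rightarrow> 'k list set" where
  "orbit_closure v = {x. length x = m \<and> (\<forall>p\<in>orbit_ideal v. p x = 0)}"

lemma closed_orbit_closure: "zariski_closed m (orbit_closure v)"
  unfolding zariski_closed_def orbit_closure_def orbit_ideal_def
  by (intro exI[of _ "{p \<in> polyfun m. \<forall>h\<in>H. p (act h v) = 0}"]) auto

lemma orbit_in_closure: "h \<in> H \<Longrightarrow> act h v \<in> orbit_closure v"
  by (simp add: orbit_closure_def orbit_ideal_def)

lemma orbit_closure_minimal:
  assumes "zariski_closed m Y" "\<And>h. h \<in> H \<Longrightarrow> act h v \<in> Y"
  shows "orbit_closure v \<subseteq> Y"
proof -
  obtain F where F: "F \<subseteq> polyfun m" "Y = {x. length x = m \<and> (\<forall>f\<in>F. f x = 0)}"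
    using assms(1) unfolding zariski_closed_def by blast
  then have "F \<subseteq> orbit_ideal v" using assms(2) by (auto simp: orbit_ideal_def)
  then show ?thesis using F by (auto simp: orbit_closure_def)
qed

text \<open>If two closed sets cover the closure, their preimages under the orbit map are closed and
  cover \<open>H\<close>, so one preimage is \<open>H\<close> and that closed set contains the
  closure. Observability is available on irreducible varieties, hence this check.\<close>

lemma irreducible_orbit_closure: "irreducible_closed m (orbit_closure v)"
  unfolding irreducible_closed_def
proof (intro conjI allI impI; (elim conjE)?)
  show "orbit_closure v \<noteq> {}" using orbit_in_closure[OF e_in] by blast
  fix Y Z assume YZ: "zariski_closed m Y" "zariski_closed m Z" "orbit_closure v = Y \<union> Z"
  have closed_pre: "zariski_closed n {h \<in> H. act h v \<in> W}" if W: "zariski_closed m W" for W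
  proof -
    obtain F where F: "F \<subseteq> polyfun m" "W = {x. length x = m \<and> (\<forall>f\<in>F. f x = 0)}"
      using W unfolding zariski_closed_def by blast
    define Q where "Q = {q \<in> polyfun n. \<exists>f\<in>F. \<forall>h\<in>H. q h = f (act h v)}"
    have ex: "\<exists>q\<in>Q. q h = f (act h v)" if "f \<in> F" "h \<in> H" for f h
    proof -
      obtain q where "q \<in> polyfun n" "\<forall>h\<in>H. q h = f (act h v)"
        using orbit_pullback[of f v] F(1) \<open>f \<in> F\<close> by blast
      then show ?thesis using that unfolding Q_def by blast
    qed
    have "{h \<in> H. act h v \<in> W} = {h \<in> H. \<forall>q\<in>Q. q h = 0}"
    proof (intro Collect_cong conj_cong refl)
      fix h assume h: "h \<in> H"
      show "act h v \<in> W \<longleftrightarrow> (\<forall>q\<in>Q. q h = 0)"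
      proof
        assume "act h v \<in> W" then show "\<forall>q\<in>Q. q h = 0" using h by (auto simp: F(2) Q_def)
      next
        assume q0: "\<forall>q\<in>Q. q h = 0"
        have "f (act h v) = 0" if "f \<in> F" for f using ex[OF that h] q0 by auto
        then show "act h v \<in> W" by (simp add: F(2))
      qed
    qed
    moreover have "Q \<subseteq> polyfun n" by (auto simp: Q_def)
    ultimately show ?thesis using zariski_closed_subset[OF closed_H, of Q] by simp
  qed
  have "H = {h \<in> H. act h v \<in> Y} \<union> {h \<in> H. act h v \<in> Z}"
    using orbit_in_closure[of _ v] YZ(3) by blast
  from irr_H[OF closed_pre[OF YZ(1)] closed_pre[OF YZ(2)] this]
  have "orbit_closure v \<subseteq> Y \<or> orbit_closure v \<subseteq> Z"
    using orbit_closure_minimal[OF YZ(1)] orbit_closure_minimal[OF YZ(2)] by blast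
  with YZ(3) show "orbit_closure v = Y \<or> orbit_closure v = Z" by blast
qed (rule closed_orbit_closure)

lemma regular_action_orbit_closure: "regular_action n H mul e m (orbit_closure v) act"
  unfolding regular_action_def
proof (intro conjI ballI)
  fix h x assume h: "h \<in> H" and x: "x \<in> orbit_closure v"
  have "p (act h x) = 0" if "p \<in> orbit_ideal v" for p
  proof -
    \<comment> \<open>Translation by \<open>h\<close> maps the orbit into itself, so composing with
      it preserves the equations of the orbit.\<close>
    have mem: "(\<lambda>y. p (act h y)) \<in> orbit_ideal v"
      using that h by (auto simp: orbit_ideal_def polyfun_matvec mul_in simp flip: act_mul)
    have "\<forall>q\<in>orbit_ideal v. q x = 0" using x by (simp add: orbit_closure_def)
    from bspec[OF this mem] show ?thesis .
  qed
  then show "act h x \<in> orbit_closure v" by (simp add: orbit_closure_def)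
next
  fix x assume "x \<in> orbit_closure v"
  then show "act e x = x" by (simp add: orbit_closure_def act_e)
next
  obtain R where R: "\<And>i j. i < m \<Longrightarrow> j < m \<Longrightarrow> R i j \<in> polyfun n"
    "\<And>i j h. i < m \<Longrightarrow> j < m \<Longrightarrow> h \<in> H \<Longrightarrow> \<rho> h i j = R i j h" by (rule entries) blast
  \<comment> \<open>A point \<open>z\<close> is \<open>h\<close> followed by \<open>x\<close>:
    \<open>R i j\<close> reads only the first \<open>n\<close> entries, and coordinate
    \<open>j\<close> of \<open>x\<close> sits at position \<open>n + j\<close>.\<close>
  let ?P = "\<lambda>i z. \<Sum>j<m. R i j z * z ! (n + j)"
  show "poly_map (n + m) m (\<lambda>z. act (take n z) (drop n z)) {h @ x |h x. h \<in> H \<and> x \<in> orbit_closure v}"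
    unfolding poly_map_def
  proof (intro exI[of _ ?P] conjI allI impI ballI)
    fix i assume "i < m"
    then show "?P i \<in> polyfun (n + m)"
      by (intro polyfun_sum polyfun.mult) (auto intro: polyfun_mono[OF R(1)] polyfun.coord)
  next
    fix z assume "z \<in> {h @ x |h x. h \<in> H \<and> x \<in> orbit_closure v}"
    then obtain h x where z: "z = h @ x" "h \<in> H" "x \<in> orbit_closure v" by blast
    then have "length h = n" using zariski_closed_length[OF closed_H] by blast
    then show "act (take n z) (drop n z) = map (\<lambda>i. ?P i z) [0..<m]"
      using z by (auto simp: matvec_def polyfun_append[OF R(1)] R(2) nth_append intro!: sum.cong)
  qed
qed (simp_all add: closed_orbit_closure act_mul)

lemma zero_notin_orbit_closure:
  assumes v: "length v = m" "v \<noteq> replicate m 0"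
  shows "replicate m 0 \<notin> orbit_closure v"
proof
  let ?o = "replicate m 0"
  assume o: "?o \<in> orbit_closure v"
  let ?F = "(\<lambda>i x. x ! i) ` {..<m}"
  have "zariski_closed m {?o}"
    unfolding zariski_closed_def
    by (rule exI[of _ ?F]) (auto intro: polyfun.coord intro!: nth_equalityI)
  moreover have "act h ?o = ?o" for h by (rule nth_equalityI) auto
  moreover have "v \<in> orbit_closure v" using orbit_in_closure[OF e_in, of v] by (simp add: act_e v)
  then have "{?o} \<noteq> orbit_closure v" using v(2) by auto
  ultimately obtain f where f: "f \<in> polyfun m" "\<exists>x\<in>orbit_closure v. f x \<noteq> 0"
    "\<forall>h\<in>H. \<forall>x\<in>orbit_closure v. f (act h x) = f x" "f ?o = 0"
    using obs[OF irreducible_orbit_closure regular_action_orbit_closure, of v] o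
    unfolding observable_action_def by (elim allE[of _ "{?o}"]) auto
  \<comment> \<open>The invariant \<open>f\<close> is constant on the orbit, so
    \<open>f - f v\<close> is among the equations defining the closure, and \<open>f\<close> is
    constant there too.\<close>
  have "(\<lambda>x. f x - f v) \<in> orbit_ideal v"
    using f(3) \<open>v \<in> _\<close> by (auto simp: orbit_ideal_def polyfun_minus_const[OF f(1)])
  then have const: "f x = f v" if "x \<in> orbit_closure v" for x
    using that unfolding orbit_closure_def by fastforce
  show False using f(2,4) const[OF o] const by auto
qed

end

section \<open>Fixed vectors\<close>

context observable_group_rep
begin

text \<open>The ideal \<open>J\<close> of leading forms; geometrically, the equations of the
  asymptotic cone of the orbit closure. \<open>F\<close> may be zero, so each degree is closed under
  addition.\<close>

definition leading_ideal :: "'k list \<Rightarrow> (nat \<times> ('k list \<Rightarrow> 'k)) set" where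
  "leading_ideal v = {(d, F). F \<in> form m d \<and>
     (\<exists>G\<in>lowpoly m d. \<forall>h\<in>H. F (act h v) + G (act h v) = 0)}"

lemma leading_idealI:
  "F \<in> form m d \<Longrightarrow> G \<in> lowpoly m d \<Longrightarrow> (\<And>h. h \<in> H \<Longrightarrow> F (act h v) + G (act h v) = 0)
    \<Longrightarrow> (d, F) \<in> leading_ideal v"
  unfolding leading_ideal_def by auto

lemma leading_idealE:
  assumes "(d, F) \<in> leading_ideal v"
  obtains G where "F \<in> form m d" "G \<in> lowpoly m d" "\<And>h. h \<in> H \<Longrightarrow> F (act h v) + G (act h v) = 0"
  using assms unfolding leading_ideal_def by auto

lemma graded_ideal_leading: "graded_ideal m (leading_ideal v)"
  unfolding graded_ideal_def
proof (intro conjI allI impI; (elim conjE)?)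
  fix d and F :: "'k list \<Rightarrow> 'k" assume "(d, F) \<in> leading_ideal v"
  then show "F \<in> form m d" by (rule leading_idealE)
next
  fix d show "(d, \<lambda>x. 0) \<in> leading_ideal v"
    by (rule leading_idealI[OF form_zero lowpoly_zero]) simp
next
  fix d and F F' :: "'k list \<Rightarrow> 'k"
  assume F: "(d, F) \<in> leading_ideal v" and F': "(d, F') \<in> leading_ideal v"
  obtain G where G: "F \<in> form m d" "G \<in> lowpoly m d" "\<And>h. h \<in> H \<Longrightarrow> F (act h v) + G (act h v) = 0"
    using F by (rule leading_idealE) blast
  obtain G' where G': "F' \<in> form m d" "G' \<in> lowpoly m d" "\<And>h. h \<in> H \<Longrightarrow> F' (act h v) + G' (act h v) = 0"
    using F' by (rule leading_idealE) blast
  show "(d, \<lambda>x. F x + F' x) \<in> leading_ideal v"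
  proof (rule leading_idealI[OF form_add[OF G(1) G'(1)] lowpoly_add[OF G(2) G'(2)]])
    fix h assume "h \<in> H"
    then show "F (act h v) + F' (act h v) + (G (act h v) + G' (act h v)) = 0"
      using G(3)[of h] G'(3)[of h] by (simp add: add_eq_0_iff)
  qed
next
  fix d k and F q :: "'k list \<Rightarrow> 'k"
  assume F: "(d, F) \<in> leading_ideal v" and q: "q \<in> form m k"
  obtain G where G: "F \<in> form m d" "G \<in> lowpoly m d" "\<And>h. h \<in> H \<Longrightarrow> F (act h v) + G (act h v) = 0"
    using F by (rule leading_idealE) blast
  show "(d + k, \<lambda>x. F x * q x) \<in> leading_ideal v"
    by (rule leading_idealI[OF form_mult[OF q G(1)] lowpoly_mult_form[OF G(2) q]])
       (simp add: G(3) flip: distrib_right)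
qed

text \<open>Substituting \<open>act g\<close> keeps \<open>F\<close> a form and \<open>G\<close> of
  lower degree, and moves points of the orbit within the orbit.\<close>

lemma stable_leading: "stable_ideal (act ` H) (leading_ideal v)"
  unfolding stable_ideal_def
proof (intro ballI, clarify)
  fix g d and F :: "'k list \<Rightarrow> 'k" assume g: "g \<in> H" and F: "(d, F) \<in> leading_ideal v"
  obtain G where G: "F \<in> form m d" "G \<in> lowpoly m d" "\<And>h. h \<in> H \<Longrightarrow> F (act h v) + G (act h v) = 0"
    using F by (rule leading_idealE) blast
  show "(d, \<lambda>x. F (act g x)) \<in> leading_ideal v"
    by (rule leading_idealI[OF form_matvec[OF G(1)] lowpoly_matvec[OF G(2), where A = "\<rho> g"]])
       (simp add: G(3) g mul_in flip: act_mul)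
qed

text \<open>Positive dimension enters here: powers of the first coordinate are nonzero at the
  all-ones vector.\<close>

lemma zero_ideal_proper: "m > 0 \<Longrightarrow> proper_ideal m {(d, p). p = (\<lambda>x :: 'k list. 0)}"
  unfolding proper_ideal_def
proof
  fix d assume "m > 0"
  then have "(\<lambda>x :: 'k list. x ! 0 ^ d) (replicate m 1) \<noteq> 0" by simp
  then have "(\<lambda>x :: 'k list. x ! 0 ^ d) \<noteq> (\<lambda>x. 0)" by metis
  then show "\<exists>p\<in>form m d. (d, p) \<notin> {(d, p). p = (\<lambda>x :: 'k list. 0)}"
    using form_coord_power[OF \<open>m > 0\<close>] by blast
qed

text \<open>Every form agrees on the orbit with a polynomial of degree below \<open>N\<close>. These
  span a finite-dimensional space, so the powers of a coordinate are dependent and its values are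
  roots of one nonzero polynomial.\<close>

lemma finite_orbit_coordinates:
  assumes N: "\<And>p. p \<in> form m N \<Longrightarrow> (N, p) \<in> leading_ideal v" and j: "j < m"
  shows "finite ((\<lambda>h. act h v ! j) ` H)"
proof -
  have high: "(d, p) \<in> leading_ideal v" if "p \<in> form m d" "N \<le> d" for d p
    using improper_mono[OF graded_ideal_leading] N that by blast
  have reduce: "\<exists>q\<in>lowpoly m N. \<forall>h\<in>H. p (act h v) = q (act h v)" if "p \<in> form m d" for d p
    using that
  proof (induction d arbitrary: p rule: less_induct)
    case (less d)
    show ?case
    proof (cases "d < N")
      case True
      then show ?thesis using less.prems by (intro bexI[of _ p] lowpoly_form) auto
    next
      \<comment> \<open>In degree at least \<open>N\<close> the form \<open>p\<close> is itself a
        leading form, so on the orbit it equals \<open>- G\<close>, whose components have smaller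
        degree.\<close>
      case False
      then obtain G where G: "G \<in> lowpoly m d" "\<And>h. h \<in> H \<Longrightarrow> p (act h v) + G (act h v) = 0"
        using high[OF less.prems] by (auto elim!: leading_idealE)
      obtain F where F: "\<forall>i. F i \<in> form m i" "G = (\<lambda>x. \<Sum>i<d. F i x)" by (rule lowpolyE[OF G(1)])
      have "\<forall>i. \<exists>q. i < d \<longrightarrow> q \<in> lowpoly m N \<and> (\<forall>h\<in>H. F i (act h v) = q (act h v))"
        using less.IH F(1) by blast
      then obtain q where q: "\<And>i. i < d \<Longrightarrow> q i \<in> lowpoly m N"
        "\<And>i h. i < d \<Longrightarrow> h \<in> H \<Longrightarrow> F i (act h v) = q i (act h v)" by metis
      have "p (act h v) = (\<Sum>i<d. (\<lambda>x. - 1 * q i x) (act h v))" if "h \<in> H" for h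
        using G(2)[OF that] by (simp add: F(2) q(2) that sum_negf add_eq_0_iff2)
      moreover have "(\<lambda>x. \<Sum>i<d. - 1 * q i x) \<in> lowpoly m N"
        by (intro lowpoly_sum lowpoly_scale q(1)) simp
      ultimately show ?thesis by (intro bexI) auto
    qed
  qed
  obtain B :: "('k list \<Rightarrow> 'k) set" where B: "finite B" "lowpoly m N \<subseteq> fspan B"
    using lowpoly_finite_span[of m N] by (elim exE conjE)
  have "\<forall>i. \<exists>q. q \<in> lowpoly m N \<and> (\<forall>h\<in>H. act h v ! j ^ i = q (act h v))"
    using reduce[OF form_coord_power[OF j]] by blast
  then obtain q where q: "\<And>i. q i \<in> lowpoly m N" "\<And>i h. h \<in> H \<Longrightarrow> act h v ! j ^ i = q i (act h v)"
    by metis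
  obtain c where c: "\<exists>i\<le>card B. c i \<noteq> 0" "\<And>x. (\<Sum>i\<le>card B. c i * q i x) = 0"
    using fspan_dependence[OF B(1), of q] q(1) B(2) by blast
  define p where "p = (\<Sum>i\<le>card B. monom (c i) i)"
  have coeff: "coeff p i = (if i \<le> card B then c i else 0)" for i
    by (simp add: p_def coeff_sum)
  have "p \<noteq> 0" using c(1) coeff by (metis coeff_0)
  have "poly p (act h v ! j) = 0" if "h \<in> H" for h
  proof -
    have "poly p (act h v ! j) = (\<Sum>i\<le>card B. c i * (act h v ! j) ^ i)"
      by (simp only: p_def poly_sum poly_monom)
    also have "\<dots> = 0" unfolding q(2)[OF that] by (rule c(2))
    finally show ?thesis .
  qed
  then have "(\<lambda>h. act h v ! j) ` H \<subseteq> {x. poly p x = 0}" by blast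
  then show ?thesis using poly_roots_finite[OF \<open>p \<noteq> 0\<close>] by (rule finite_subset)
qed

lemma exists_fixed_vector:
  assumes "m > 0"
  obtains v where "length v = m" "v \<noteq> replicate m 0" "\<And>h. h \<in> H \<Longrightarrow> act h v = v"
proof -
  let ?Z = "{(d, p). p = (\<lambda>x :: 'k list. 0)} :: (nat \<times> ('k list \<Rightarrow> 'k)) set"
  have Z: "graded_ideal m ?Z" "stable_ideal (act ` H) ?Z"
    by (auto simp: graded_ideal_def stable_ideal_def form_zero)
  obtain I where I: "graded_ideal m I" "proper_ideal m I" "stable_ideal (act ` H) I"
    and max: "\<And>J. graded_ideal m J \<Longrightarrow> proper_ideal m J \<Longrightarrow> stable_ideal (act ` H) J \<Longrightarrow> I \<subseteq> J \<Longrightarrow> J = I"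
    by (rule exists_maximal_ideal[OF Z(1) zero_ideal_proper[OF assms] Z(2)]) blast
  obtain v where v: "length v = m" "v \<noteq> replicate m 0" "\<And>d p. (d, p) \<in> I \<Longrightarrow> p v = 0"
    by (rule graded_nullstellensatz[OF alg I(1,2)]) blast
  \<comment> \<open>Stability spreads the zero \<open>v\<close> of \<open>I\<close> over its whole
    orbit.\<close>
  have vanish: "p (act h v) = 0" if "(d, p) \<in> I" "h \<in> H" for d p h
  proof -
    have "(d, \<lambda>x. p (act h x)) \<in> I" using I(3) that unfolding stable_ideal_def by auto
    from v(3)[OF this] show ?thesis .
  qed
  have sub: "I \<subseteq> leading_ideal v"
  proof clarify
    fix d and p :: "'k list \<Rightarrow> 'k" assume p: "(d, p) \<in> I"
    show "(d, p) \<in> leading_ideal v"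
      by (rule leading_idealI[OF graded_ideal_form[OF I(1) p] lowpoly_zero]) (simp add: vanish[OF p])
  qed
  have "\<not> proper_ideal m (leading_ideal v)"
  proof
    assume "proper_ideal m (leading_ideal v)"
    from max[OF graded_ideal_leading this stable_leading sub]
    have eq: "leading_ideal v = I" .
    have zero: "p (replicate m 0) = 0" if "p \<in> lowpoly m d" "\<forall>h\<in>H. p (act h v) = 0" for d p
      using that
    proof (induction d arbitrary: p)
      case 0
      then show ?case by (auto simp: lowpoly_def)
    next
      case (Suc d)
      obtain F where F: "\<forall>i. F i \<in> form m i" "p = (\<lambda>x. \<Sum>i<Suc d. F i x)"
        by (rule lowpolyE[OF Suc.prems(1)])
      let ?G = "\<lambda>x. \<Sum>i<d. F i x"
      have G: "?G \<in> lowpoly m d" using F(1) by (intro lowpolyI) blast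
      \<comment> \<open>Since this ideal equals \<open>I\<close>, the top form \<open>F d\<close>
        vanishes on the orbit by itself, and so does the rest \<open>?G\<close>.\<close>
      have "(d, F d) \<in> leading_ideal v"
        using Suc.prems(2) F by (intro leading_idealI[OF _ G]) (auto simp: add.commute)
      then have Fd: "(d, F d) \<in> I" by (simp add: eq)
      then have "?G (replicate m 0) = 0"
        using Suc.prems(2) vanish[OF Fd] by (intro Suc.IH[OF G]) (auto simp: F(2))
      \<comment> \<open>A constant in \<open>I\<close> is 0 because it vanishes at \<open>v\<close>;
        a form of positive degree always vanishes at the origin.\<close>
      moreover have "F d (replicate m 0) = 0"
      proof (cases "d = 0")
        case True
        obtain c where "F d = (\<lambda>x. c)" using form_0_const[of "F d" m] F(1) True by blast
        then show ?thesis using v(3)[OF Fd] by simp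
      qed (use form_at_zero F(1) in blast)
      ultimately show ?case by (simp add: F(2))
    qed
    have "replicate m 0 \<in> orbit_closure v"
      unfolding orbit_closure_def orbit_ideal_def using zero polyfun_lowpoly by fastforce
    then show False using zero_notin_orbit_closure[OF v(1,2)] by blast
  qed
  then obtain N where N: "\<And>p. p \<in> form m N \<Longrightarrow> (N, p) \<in> leading_ideal v"
    unfolding proper_ideal_def by auto
  have "act h v ! j = v ! j" if h: "h \<in> H" and j: "j < m" for h j
  proof -
    obtain q where q: "q \<in> polyfun n" "\<forall>h\<in>H. q h = act h v ! j"
      using orbit_pullback[OF polyfun.coord[OF j]] by blast
    have "q ` H = (\<lambda>h. act h v ! j) ` H" using q(2) by (intro image_cong) auto
    with finite_orbit_coordinates[OF N j] have "finite (q ` H)" by simp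
    from irreducible_finite_image_constant[OF irr q(1) this] obtain c where "\<forall>h\<in>H. q h = c" by blast
    then have "act h v ! j = act e v ! j" using h e_in q(2) by metis
    then show ?thesis by (simp add: act_e[OF v(1)])
  qed
  then have "act h v = v" if "h \<in> H" for h
    using that v(1) by (intro nth_equalityI) auto
  with v(1,2) that show ?thesis by blast
qed

end

section \<open>Quotient by a fixed line\<close>

text \<open>A matrix \<open>M\<close> with eigenvector \<open>v\<close>, \<open>v\<^sub>r = 1\<close>, acts on the quotient by the line of \<open>v\<close>;
  the quotient coordinates of \<open>w\<close> are \<open>w\<^sub>i - v\<^sub>i w\<^sub>r\<close> for \<open>i \<noteq> r\<close>, enumerated by \<open>s\<close>.\<close>

definition quotient_matrix ::
  "(nat \<Rightarrow> nat) \<Rightarrow> nat \<Rightarrow> (nat \<Rightarrow> 'k::field) \<Rightarrow> (nat \<Rightarrow> nat \<Rightarrow> 'k) \<Rightarrow> nat \<Rightarrow> nat \<Rightarrow> 'k" where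
  "quotient_matrix s r v M i j = M (s i) (s j) - v (s i) * M r (s j)"

text \<open>The sum extends over all \<open>k\<close> because the term at \<open>k = r\<close>
  vanishes by \<open>v r = 1\<close>. The contribution of \<open>v\<close> cancels since both
  eigenvector terms equal \<open>c * v (s i)\<close>.\<close>

lemma quotient_matrix_intertwines:
  fixes M :: "nat \<Rightarrow> nat \<Rightarrow> 'k::field"
  assumes s: "bij_betw s {..<m'} ({..<m} - {r})" and r: "r < m" "v r = 1"
    and eigen: "\<And>i. i < m \<Longrightarrow> (\<Sum>k<m. M i k * v k) = c * v i" and i: "i < m'"
  shows "(\<Sum>l<m'. quotient_matrix s r v M i l * (w (s l) - v (s l) * w r)) =
    (\<Sum>k<m. M (s i) k * w k) - v (s i) * (\<Sum>k<m. M r k * w k)"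
proof -
  have si: "s i < m" using s i by (auto simp: bij_betw_def)
  let ?b = "\<lambda>k. M (s i) k - v (s i) * M r k"
  have "(\<Sum>l<m'. quotient_matrix s r v M i l * (w (s l) - v (s l) * w r)) =
      (\<Sum>k\<in>{..<m} - {r}. ?b k * (w k - v k * w r))"
    unfolding quotient_matrix_def by (rule sum.reindex_bij_betw[OF s])
  also have "\<dots> = (\<Sum>k<m. ?b k * (w k - v k * w r))"
    by (rule sum.mono_neutral_left) (auto simp: r)
  also have "\<dots> = (\<Sum>k<m. ?b k * w k) - (\<Sum>k<m. ?b k * v k) * w r"
    by (simp add: sum_subtractf[symmetric] sum_distrib_right right_diff_distrib mult.assoc)
  also have "(\<Sum>k<m. ?b k * v k) = (\<Sum>k<m. M (s i) k * v k) - v (s i) * (\<Sum>k<m. M r k * v k)"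
    by (simp add: sum_subtractf sum_distrib_left algebra_simps)
  also have "\<dots> = 0" by (simp add: eigen si r)
  also have "(\<Sum>k<m. ?b k * w k) = (\<Sum>k<m. M (s i) k * w k) - v (s i) * (\<Sum>k<m. M r k * w k)"
    by (simp add: sum_subtractf sum_distrib_left algebra_simps)
  finally show ?thesis by simp
qed

text \<open>Column \<open>s j\<close> of \<open>M'\<close> serves as the vector \<open>w\<close> in
  the intertwining identity.\<close>

lemma quotient_matrix_mult:
  assumes s: "bij_betw s {..<m'} ({..<m} - {r})" and r: "r < m" "v r = 1"
    and eigen: "\<And>i. i < m \<Longrightarrow> (\<Sum>k<m. M i k * v k) = c * v i" and ij: "i < m'" "j < m'"
  shows "mat_mul m' (quotient_matrix s r v M) (quotient_matrix s r v M') i j =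
    quotient_matrix s r v (mat_mul m M M') i j"
  using quotient_matrix_intertwines[where w = "\<lambda>k. M' k (s j)" and v = v, OF s r eigen ij(1)]
  by (simp add: mat_mul_def quotient_matrix_def)

text \<open>If the \<open>N\<close>-th power vanishes on the quotient, then \<open>M\<close> to the
  power \<open>N\<close> maps everything into the line of \<open>v\<close>, which one more factor
  \<open>M\<close> kills.\<close>

lemma quotient_matrix_pow:
  assumes s: "bij_betw s {..<m'} ({..<m} - {r})" and r: "r < m" "v r = 1"
    and kernel: "\<And>i. i < m \<Longrightarrow> (\<Sum>k<m. M i k * v k) = 0"
    and nil: "\<And>i j. i < m' \<Longrightarrow> j < m' \<Longrightarrow> mat_pow m' (quotient_matrix s r v M) N i j = 0"
    and ij: "i < m" "j < m"
  shows "mat_pow m M (Suc N) i j = 0"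
proof -
  let ?q = "\<lambda>w i. w (s i) - v (s i) * w r"
  let ?A = "quotient_matrix s r v M"
  \<comment> \<open>Column \<open>j\<close> of the power is the image of the \<open>j\<close>-th
    unit vector; its quotient coordinates come from applying \<open>?A\<close> that many
    times.\<close>
  have pow: "?q (\<lambda>k. mat_pow m M N k j) i =
      (\<Sum>l<m'. mat_pow m' ?A N i l * ?q (\<lambda>k. mat_id k j) l)" if "i < m'" for i N
    using that
  proof (induction N arbitrary: i)
    case 0
    then show ?case
      by (simp add: mat_id_def[of i] if_distrib[of "\<lambda>c. c * _"] cong: if_cong)
  next
    case (Suc N)
    have "?q (\<lambda>k. mat_pow m M (Suc N) k j) i =
        (\<Sum>l<m'. ?A i l * ?q (\<lambda>k. mat_pow m M N k j) l)"
      using quotient_matrix_intertwines[where v = v, OF s r, of M 0 i "\<lambda>k. mat_pow m M N k j"] kernel Suc.prems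
      by (simp add: mat_mul_def)
    also have "\<dots> = (\<Sum>l<m'. \<Sum>l'<m'. ?A i l * mat_pow m' ?A N l l' * ?q (\<lambda>k. mat_id k j) l')"
      by (rule sum.cong) (simp_all add: Suc.IH sum_distrib_left mult.assoc)
    also have "\<dots> = (\<Sum>l'<m'. \<Sum>l<m'. ?A i l * mat_pow m' ?A N l l' * ?q (\<lambda>k. mat_id k j) l')"
      by (rule sum.swap)
    also have "\<dots> = (\<Sum>l<m'. mat_pow m' ?A (Suc N) i l * ?q (\<lambda>k. mat_id k j) l)"
      by (simp add: mat_mul_def sum_distrib_right)
    finally show ?case .
  qed
  define w where "w = (\<lambda>k. mat_pow m M N k j)"
  have "w k = v k * w r" if "k < m" for k
  proof (cases "k = r")
    case False
    then have "k \<in> s ` {..<m'}" using that by (simp add: bij_betw_imp_surj_on[OF s])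
    then obtain l where l: "l < m'" "k = s l" by auto
    have "?q w l = 0" using pow[OF l(1), of N] by (simp add: nil l(1) w_def)
    then show ?thesis by (simp add: l(2))
  qed (simp add: r)
  then have "(\<Sum>k<m. M i k * w k) = (\<Sum>k<m. M i k * v k) * w r"
    by (simp add: sum_distrib_right mult.assoc)
  then show ?thesis by (simp add: mat_mul_def kernel[OF ij(1)] w_def)
qed

section \<open>Unipotence by induction on the dimension\<close>

lemma mat_pow_cong:
  assumes "\<And>i j. i < m \<Longrightarrow> j < m \<Longrightarrow> A i j = B i j"
  shows "i < m \<Longrightarrow> j < m \<Longrightarrow> mat_pow m A N i j = mat_pow m B N i j"
  by (induction N arbitrary: i) (simp_all add: mat_mul_def assms)

text \<open>The quotient by a fixed line is again a rational representation, of dimension one less;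
  its nilpotency exponent grows by one when lifted back.\<close>

lemma rational_rep_unipotent:
  fixes H :: "'k::field list set"
  assumes alg: "alg_closed_field TYPE('k)"
    and group: "affine_algebraic_group n H mul ginv e"
    and irr: "irreducible_closed n H"
    and obs: "\<And>m X act. irreducible_closed m X \<Longrightarrow> regular_action n H mul e m X act
                   \<Longrightarrow> observable_action H m X act"
    and h: "h \<in> H"
  shows "rational_rep n H mul e m \<rho> \<Longrightarrow>
    \<exists>N. \<forall>i<m. \<forall>j<m. mat_pow m (\<lambda>a b. \<rho> h a b - mat_id a b) N i j = 0"
proof (induction m arbitrary: \<rho>)
  case (Suc m)
  interpret observable_group_rep H mul ginv e n "Suc m" \<rho>
    using alg group irr obs Suc.prems by unfold_locales
  obtain u where u: "length u = Suc m" "u \<noteq> replicate (Suc m) 0" "\<And>h. h \<in> H \<Longrightarrow> act h u = u"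
    by (rule exists_fixed_vector) auto
  from u(1,2) obtain r where r: "r < Suc m" "u ! r \<noteq> 0"
    by (metis length_replicate nth_equalityI nth_replicate)
  \<comment> \<open>The fixed vector is rescaled to have entry 1 at \<open>r\<close>, as the
    quotient coordinates require.\<close>
  define v where "v i = u ! i / u ! r" for i
  have vr: "v r = 1" using r by (simp add: v_def)
  have fixed: "(\<Sum>k<Suc m. \<rho> g i k * v k) = 1 * v i" if "g \<in> H" "i < Suc m" for g i
  proof -
    have "(\<Sum>k<Suc m. \<rho> g i k * v k) = act g u ! i / u ! r"
      using that(2) by (simp only: nth_matvec sum_divide_distrib v_def times_divide_eq_right)
    then show ?thesis using u(3)[OF that(1)] by (simp add: v_def)
  qed
  obtain s where s: "bij_betw s {..<m} ({..<Suc m} - {r})"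
    using ex_bij_betw_nat_finite[of "{..<Suc m} - {r}"] r(1) by (auto simp: atLeast0LessThan)
  have s_lt: "s i < Suc m" "s i \<noteq> r" if "i < m" for i using s that by (auto simp: bij_betw_def)
  have s_eq: "s i = s j \<longleftrightarrow> i = j" if "i < m" "j < m" for i j
    using s that by (auto simp: bij_betw_def inj_on_def)
  have q_id: "quotient_matrix s r v mat_id i j = mat_id i j" if "i < m" "j < m" for i j
    using that s_lt by (auto simp: quotient_matrix_def mat_id_def s_eq)
  let ?\<rho> = "\<lambda>h. quotient_matrix s r v (\<rho> h)"
  have "rational_rep n H mul e m ?\<rho>"
    unfolding rational_rep_def
  proof (intro conjI allI impI ballI)
    obtain R where R: "\<And>i j. i < Suc m \<Longrightarrow> j < Suc m \<Longrightarrow> R i j \<in> polyfun n"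
      "\<And>i j h. i < Suc m \<Longrightarrow> j < Suc m \<Longrightarrow> h \<in> H \<Longrightarrow> \<rho> h i j = R i j h" by (rule entries) blast
    fix i j assume ij: "i < m" "j < m"
    have "(\<lambda>h. R (s i) (s j) h + (- v (s i)) * R r (s j) h) \<in> polyfun n"
      using ij s_lt r(1) by (intro polyfun.add polyfun_scale R(1)) auto
    moreover have "?\<rho> h i j = R (s i) (s j) h + (- v (s i)) * R r (s j) h" if "h \<in> H" for h
      using ij s_lt r(1) that by (simp add: quotient_matrix_def R(2))
    ultimately show "\<exists>p\<in>polyfun n. \<forall>h\<in>H. ?\<rho> h i j = p h" by (intro bexI) auto
  next
    fix i j assume ij: "i < m" "j < m"
    then have "?\<rho> e i j = quotient_matrix s r v mat_id i j"
      using s_lt r(1) by (simp add: quotient_matrix_def rho_e)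
    then show "?\<rho> e i j = mat_id i j" using q_id ij by simp
  next
    fix g h i j assume gh: "g \<in> H" "h \<in> H" and ij: "i < m" "j < m"
    have "?\<rho> (mul g h) i j = quotient_matrix s r v (mat_mul (Suc m) (\<rho> g) (\<rho> h)) i j"
      using s_lt r(1) ij by (simp add: quotient_matrix_def rho_mul[OF gh])
    also have "\<dots> = mat_mul m (?\<rho> g) (?\<rho> h) i j"
      by (rule quotient_matrix_mult[where v = v, OF s r(1) vr fixed[OF gh(1)] ij, symmetric])
    finally show "?\<rho> (mul g h) i j = mat_mul m (?\<rho> g) (?\<rho> h) i j" .
  qed
  from Suc.IH[OF this] obtain N where
    N: "\<forall>i<m. \<forall>j<m. mat_pow m (\<lambda>a b. ?\<rho> h a b - mat_id a b) N i j = 0" ..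
  let ?M = "\<lambda>a b. \<rho> h a b - mat_id a b"
  \<comment> \<open>Passing to the quotient is linear in the matrix and sends the identity to the
    identity.\<close>
  have agree: "quotient_matrix s r v ?M i j = ?\<rho> h i j - mat_id i j" if "i < m" "j < m" for i j
    using q_id[OF that] by (simp add: quotient_matrix_def algebra_simps)
  have "mat_pow m (quotient_matrix s r v ?M) N i j = 0" if "i < m" "j < m" for i j
    using N that mat_pow_cong[of m "quotient_matrix s r v ?M", OF agree that] by simp
  \<comment> \<open>The eigenvalue 1 of \<open>\<rho> h\<close> on \<open>v\<close> becomes 0 for
    \<open>?M\<close>.\<close>
  moreover have "(\<Sum>k<Suc m. ?M i k * v k) = 0" if "i < Suc m" for i
  proof -
    have "(\<Sum>k<Suc m. mat_id i k * v k) = v i"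
      using that by (simp only: mat_id_def if_distrib[of "\<lambda>c. c * _"] mult_1 mult_zero_left sum.delta'
          finite_lessThan lessThan_iff if_True cong: if_cong)
    then show ?thesis using fixed[OF h that]
      by (simp only: left_diff_distrib sum_subtractf mult_1 diff_self)
  qed
  ultimately have "mat_pow (Suc m) ?M (Suc N) i j = 0" if "i < Suc m" "j < Suc m" for i j
    using quotient_matrix_pow[where v = v, OF s r(1) vr, of ?M N i j] that by blast
  then show ?case by blast
qed simp

theorem theorem6p6:
  fixes H :: "'k::field list set"
    and mul :: "'k list \<Rightarrow> 'k list \<Rightarrow> 'k list"
    and ginv :: "'k list \<Rightarrow> 'k list"
    and e :: "'k list"
    and n :: nat
  assumes "alg_closed_field TYPE('k)"
    and "affine_algebraic_group n H mul ginv e"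
    and "irreducible_closed n H"
    and "\<forall>m X act. irreducible_closed m X \<and> regular_action n H mul e m X act
                   \<longrightarrow> observable_action H m X act"
  shows "unipotent_group n H mul e"
  unfolding unipotent_group_def
  using rational_rep_unipotent[OF assms(1-3)] assms(4) by blast

end
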